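(* Let $(x_n)_n$ be a frame or an outer frame for a Hilbert $C^*$-module $X$ over a $C^*$-algebra $\mathsf{A}$, with analysis operator $U$ and optimal lower frame bound $A$. Suppose that $V\in\mathbb{B}(X,\ell^2(\mathsf{A}))$ satisfies $\|U-V\|<\sqrt{A}$. Then $V$ is the analysis operator of a frame or an outer frame $(y_n)_n$ for $X$ such that $$\|x_n-y_n\|\le\|U-V\|<\sqrt{A},\quad\forall n\in\mathbb{N}$$ (norms of elements computed in $M(X)$).
   Context: $\mathsf{A}$ is an arbitrary $C^*$-algebra (not necessarily unital) with multiplier algebra $M(\mathsf{A})$. Hilbert $\mathsf{A}$-modules are right modules with inner product $\mathsf{A}$-linear in the second variable; they are not assumed full. $\mathbb{B}(X,Y)$ denotes the adjointable operators from $X$ to $Y$. $\ell^2(\mathsf{A})$ is the Hilbert $\mathsf{A}$-module of sequences $(a_n)_n$ in $\mathsf{A}$ with $\sum_n a_n^*a_n$ norm convergent, with inner product $\langle (a_n)_n,(b_n)_n\rangle=\sum_n a_n^*b_n$. $M(X)$ denotes the multiplier module of $X$: $M(X)=\mathbb{B}(\mathsf{A},X)$, a Hilbert $M(\mathsf{A})$-module with $\langle v,w\rangle=v^*w\in\mathbb{B}(\mathsf{A})=M(\mathsf{A})$, containing $X$ (isometrically) via $x\mapsto(a\mapsto xa)$, and $M(X)\mathsf{A}=X$; thus $\langle v,x\rangle\in\mathsf{A}$ for $v\in M(X)$, $x\in X$. All sequences are infinite, indexed by $\mathbb{N}$ (finite frames are extended by zeros). A sequence $(x_n)_n$ in $X$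 is a frame for $X$ if there are constants $A,B>0$ with $A\langle x,x\rangle\le\sum_{n=1}^\infty\langle x,x_n\rangle\langle x_n,x\rangle\le B\langle x,x\rangle$ for all $x\in X$, the series converging in norm. A sequence $(x_n)_n$ in $M(X)$ is an outer frame for $X$ if $x_n\in M(X)\setminus X$ for at least one $n$ and the same inequalities hold for all $x\in X$ (with norm convergence in $\mathsf{A}$) for some $A,B>0$. The optimal lower frame bound is the largest possible constant $A$ in these inequalities. The analysis operator of a frame or outer frame $(x_n)_n$ is $U\in\mathbb{B}(X,\ell^2(\mathsf{A}))$, $Ux=(\langle x_n,x\rangle)_n$. *)

theory Defs
  imports "HOL-Analysis.Analysis"
begin

section \<open>C*-algebras\<close>

class complex_vector = real_vector +
  fixes scaleC :: "complex \<Rightarrow> 'a \<Rightarrow> 'a"  (infixr "*\<^sub>C" 75)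
  assumes scaleC_add_right: "c *\<^sub>C (x + y) = c *\<^sub>C x + c *\<^sub>C y"
    and scaleC_add_left: "(c + d) *\<^sub>C x = c *\<^sub>C x + d *\<^sub>C x"
    and scaleC_scaleC: "c *\<^sub>C d *\<^sub>C x = (c * d) *\<^sub>C x"
    and scaleC_of_real: "complex_of_real r *\<^sub>C x = r *\<^sub>R x"

class complex_normed_vector = complex_vector + real_normed_vector +
  assumes norm_scaleC: "norm (c *\<^sub>C x) = cmod c * norm x"

text \<open>Neither a unit nor \<open>0 \<noteq> 1\<close> is required.\<close>

class cstar_algebra = complex_normed_vector + real_normed_algebra + banach +
  fixes star :: "'a \<Rightarrow> 'a"
  assumes mult_scaleC_left: "(c *\<^sub>C a) * b = c *\<^sub>C (a * b)"
    and mult_scaleC_right: "a * (c *\<^sub>C b) = c *\<^sub>C (a * b)"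
    and star_add: "star (a + b) = star a + star b"
    and star_scaleC: "star (c *\<^sub>C a) = cnj c *\<^sub>C star a"
    and star_mult: "star (a * b) = star b * star a"
    and star_star [simp]: "star (star a) = a"
    and norm_star_mult_self: "norm (star a * a) = (norm a)\<^sup>2"

instantiation complex :: cstar_algebra
begin

definition scaleC_complex :: "complex \<Rightarrow> complex \<Rightarrow> complex"
  where "scaleC_complex c z = c * z"

definition star_complex :: "complex \<Rightarrow> complex"
  where "star_complex z = cnj z"

instance
  by standard
    (auto simp: scaleC_complex_def star_complex_def algebra_simps scaleR_conv_of_real
      norm_mult power2_eq_square)

end

definition cstar_le :: "'a::cstar_algebra \<Rightarrow> 'a \<Rightarrow> bool"  (infix "\<le>\<^sub>C" 50)
  where "a \<le>\<^sub>C b \<longleftrightarrow> (\<exists>c. b - a = star c * c)"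


section \<open>Hilbert C*-modules\<close>

text \<open>Right modules; the norm of the type \<open>'x\<close> is required to be the one induced by the inner
  product, so definiteness and completeness of the module are those of the normed space \<open>'x\<close>.
  Fullness is not required.\<close>

locale hilbert_module =
  fixes act :: "'x::{complex_normed_vector, banach} \<Rightarrow> 'a::cstar_algebra \<Rightarrow> 'x"
    and ip :: "'x \<Rightarrow> 'x \<Rightarrow> 'a"
  assumes act_add_left: "act (x + y) a = act x a + act y a"
    and act_add_right: "act x (a + b) = act x a + act x b"
    and act_act: "act (act x a) b = act x (a * b)"
    and act_scaleC_left: "act (c *\<^sub>C x) a = c *\<^sub>C act x a"
    and act_scaleC_right: "act x (c *\<^sub>C a) = c *\<^sub>C act x a"
    and ip_add_right: "ip x (y + z) = ip x y + ip x z"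
    and ip_scaleC_right: "ip x (c *\<^sub>C y) = c *\<^sub>C ip x y"
    and ip_act_right: "ip x (act y a) = ip x y * a"
    and star_ip: "star (ip x y) = ip y x"
    and ip_nonneg: "0 \<le>\<^sub>C ip x x"
    and norm_eq_sqrt_ip: "norm x = sqrt (norm (ip x x))"

definition cstar_ip :: "'a::cstar_algebra \<Rightarrow> 'a \<Rightarrow> 'a"
  where "cstar_ip a b = star a * b"

lemma hilbert_module_cstar: "hilbert_module (*) (cstar_ip :: 'a::cstar_algebra \<Rightarrow> 'a \<Rightarrow> 'a)"
  by standard
    (auto simp: cstar_ip_def cstar_le_def algebra_simps mult_scaleC_left mult_scaleC_right
      star_mult norm_star_mult_self)

definition ell2 :: "(nat \<Rightarrow> 'a::cstar_algebra) set"
  where "ell2 = {a. summable (\<lambda>n. star (a n) * a n)}"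

definition ell2_ip :: "(nat \<Rightarrow> 'a::cstar_algebra) \<Rightarrow> (nat \<Rightarrow> 'a) \<Rightarrow> 'a"
  where "ell2_ip a b = (\<Sum>n. star (a n) * b n)"

definition ell2_norm :: "(nat \<Rightarrow> 'a::cstar_algebra) \<Rightarrow> real"
  where "ell2_norm a = sqrt (norm (ell2_ip a a))"


section \<open>Adjointable operators\<close>

text \<open>Modules are given here by a carrier and an inner product. Linearity and boundedness of
  adjointable operators are automatic.\<close>

definition is_adjoint ::
    "'x set \<Rightarrow> ('x \<Rightarrow> 'x \<Rightarrow> 'a) \<Rightarrow> 'y set \<Rightarrow> ('y \<Rightarrow> 'y \<Rightarrow> 'a) \<Rightarrow> ('x \<Rightarrow> 'y) \<Rightarrow> ('y \<Rightarrow> 'x) \<Rightarrow> bool"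
  where "is_adjoint E ipE F ipF T S \<longleftrightarrow>
    T ` E \<subseteq> F \<and> S ` F \<subseteq> E \<and> (\<forall>x\<in>E. \<forall>y\<in>F. ipF (T x) y = ipE x (S y))"

definition adjointable ::
    "'x set \<Rightarrow> ('x \<Rightarrow> 'x \<Rightarrow> 'a) \<Rightarrow> 'y set \<Rightarrow> ('y \<Rightarrow> 'y \<Rightarrow> 'a) \<Rightarrow> ('x \<Rightarrow> 'y) set"
  where "adjointable E ipE F ipF = {T. \<exists>S. is_adjoint E ipE F ipF T S}"

text \<open>The space of adjointable operators from \<open>X\<close> to \<open>\<ell>\<^sup>2(A)\<close> and its operator norm.\<close>

definition adjointable_ell2 ::
    "('x \<Rightarrow> 'x \<Rightarrow> 'a::cstar_algebra) \<Rightarrow> ('x \<Rightarrow> nat \<Rightarrow> 'a) set"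
  where "adjointable_ell2 ip = adjointable UNIV ip ell2 ell2_ip"

definition onorm_ell2 :: "('x::real_normed_vector \<Rightarrow> nat \<Rightarrow> 'a::cstar_algebra) \<Rightarrow> real"
  where "onorm_ell2 T = (SUP x\<in>{x. norm x \<le> 1}. ell2_norm (T x))"


section \<open>The multiplier module\<close>

definition multiplier_module ::
    "('x \<Rightarrow> 'x \<Rightarrow> 'a::cstar_algebra) \<Rightarrow> ('a \<Rightarrow> 'x) set"
  where "multiplier_module ip = adjointable UNIV cstar_ip UNIV ip"

definition mult_adj ::
    "('x \<Rightarrow> 'x \<Rightarrow> 'a::cstar_algebra) \<Rightarrow> ('a \<Rightarrow> 'x) \<Rightarrow> 'x \<Rightarrow> 'a"
  where "mult_adj ip v = (THE S. is_adjoint UNIV cstar_ip UNIV ip v S)"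

text \<open>The inner product of the multiplier module takes values in the algebra of adjointable
  operators on \<open>A\<close>, with the operator norm.\<close>

definition mult_ip ::
    "('x \<Rightarrow> 'x \<Rightarrow> 'a::cstar_algebra) \<Rightarrow> ('a \<Rightarrow> 'x) \<Rightarrow> ('a \<Rightarrow> 'x) \<Rightarrow> 'a \<Rightarrow> 'a"
  where "mult_ip ip v w = mult_adj ip v \<circ> w"

definition mult_norm ::
    "('x \<Rightarrow> 'x \<Rightarrow> 'a::cstar_algebra) \<Rightarrow> ('a \<Rightarrow> 'x) \<Rightarrow> real"
  where "mult_norm ip v = sqrt (onorm (mult_ip ip v v))"

text \<open>The embedding of \<open>X\<close> into the multiplier module.\<close>

definition mult_embed :: "('x \<Rightarrow> 'a \<Rightarrow> 'x) \<Rightarrow> 'x \<Rightarrow> 'a \<Rightarrow> 'x"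
  where "mult_embed act x = (\<lambda>a. act x a)"

text \<open>For \<open>v\<close> in the multiplier module and \<open>x\<close> in \<open>X\<close>, the operator \<open>\<langle>v, x\<rangle>\<close> on \<open>A\<close> is left
  multiplication by \<open>v\<^sup>*x\<close>, with which it is identified; see \<open>mult_ip_embed_right\<close> below.\<close>

definition mult_pairing ::
    "('x \<Rightarrow> 'x \<Rightarrow> 'a::cstar_algebra) \<Rightarrow> ('a \<Rightarrow> 'x) \<Rightarrow> 'x \<Rightarrow> 'a"
  where "mult_pairing ip v x = mult_adj ip v x"

context hilbert_module
begin

lemma mult_adj_unique:
  assumes "is_adjoint UNIV cstar_ip UNIV ip v S"
  shows "mult_adj ip v = S"
  unfolding mult_adj_def
proof (rule the_equality)
  show "is_adjoint UNIV cstar_ip UNIV ip v S" by (fact assms)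
next
  fix T assume T: "is_adjoint UNIV cstar_ip UNIV ip v T"
  show "T = S"
  proof
    fix x
    have "star (T x - S x) * (T x - S x) = 0"
      using T assms by (simp add: is_adjoint_def cstar_ip_def right_diff_distrib)
    then show "T x = S x"
      using norm_star_mult_self[of "T x - S x"] by simp
  qed
qed

lemma is_adjoint_mult_adj:
  assumes "v \<in> multiplier_module ip"
  shows "is_adjoint UNIV cstar_ip UNIV ip v (mult_adj ip v)"
  using assms mult_adj_unique by (auto simp: multiplier_module_def adjointable_def)

lemma ip_act_left: "ip (act x a) y = star a * ip x y"
  by (metis ip_act_right star_ip star_mult)

lemma is_adjoint_mult_embed: "is_adjoint UNIV cstar_ip UNIV ip (mult_embed act x) (ip x)"
  by (simp add: is_adjoint_def cstar_ip_def mult_embed_def ip_act_left)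

lemma mult_embed_in: "mult_embed act x \<in> multiplier_module ip"
  using is_adjoint_mult_embed by (auto simp: multiplier_module_def adjointable_def)

lemma mult_pairing_embed: "mult_pairing ip (mult_embed act x) y = ip x y"
  by (simp add: mult_pairing_def mult_adj_unique[OF is_adjoint_mult_embed])

lemma mult_ip_embed_right:
  assumes "v \<in> multiplier_module ip"
  shows "mult_ip ip v (mult_embed act x) = (\<lambda>a. mult_pairing ip v x * a)"
proof
  fix a
  let ?S = "mult_adj ip v"
  have adj: "ip (v b) y = star b * ?S y" for b y
    using is_adjoint_mult_adj[OF assms] by (simp add: is_adjoint_def cstar_ip_def)
  define d where "d = ?S (act x a) - ?S x * a"
  have "star b * ?S (act x a) = star b * (?S x * a)" for b
    using adj[of b "act x a"] adj[of b x] by (simp add: ip_act_right mult.assoc)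
  then have "star d * d = 0"
    unfolding d_def by (simp only: right_diff_distrib) simp
  then have "d = 0"
    using norm_star_mult_self[of d] by simp
  then show "mult_ip ip v (mult_embed act x) a = mult_pairing ip v x * a"
    by (simp add: mult_ip_def mult_embed_def mult_pairing_def d_def)
qed

end


section \<open>Frames and outer frames\<close>

definition is_frame :: "('x \<Rightarrow> 'x \<Rightarrow> 'a::cstar_algebra) \<Rightarrow> (nat \<Rightarrow> 'x) \<Rightarrow> bool"
  where "is_frame ip f \<longleftrightarrow> (\<exists>A>0. \<exists>B>0. \<forall>x.
    summable (\<lambda>n. ip x (f n) * ip (f n) x) \<and>
    A *\<^sub>R ip x x \<le>\<^sub>C (\<Sum>n. ip x (f n) * ip (f n) x) \<and>
    (\<Sum>n. ip x (f n) * ip (f n) x) \<le>\<^sub>C B *\<^sub>R ip x x)"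

text \<open>The frame inequalities for a sequence in the multiplier module; \<open>\<langle>x, v\<rangle>\<close> is the adjoint
  of \<open>\<langle>v, x\<rangle>\<close>.\<close>

definition frame_bounds ::
    "('x \<Rightarrow> 'x \<Rightarrow> 'a::cstar_algebra) \<Rightarrow> (nat \<Rightarrow> 'a \<Rightarrow> 'x) \<Rightarrow> real \<Rightarrow> real \<Rightarrow> bool"
  where "frame_bounds ip v A B \<longleftrightarrow> A > 0 \<and> B > 0 \<and> (\<forall>x.
    summable (\<lambda>n. star (mult_pairing ip (v n) x) * mult_pairing ip (v n) x) \<and>
    A *\<^sub>R ip x x \<le>\<^sub>C (\<Sum>n. star (mult_pairing ip (v n) x) * mult_pairing ip (v n) x) \<and>
    (\<Sum>n. star (mult_pairing ip (v n) x) * mult_pairing ip (v n) x) \<le>\<^sub>C B *\<^sub>R ip x x)"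

definition is_outer_frame ::
    "('x \<Rightarrow> 'a \<Rightarrow> 'x) \<Rightarrow> ('x \<Rightarrow> 'x \<Rightarrow> 'a::cstar_algebra) \<Rightarrow> (nat \<Rightarrow> 'a \<Rightarrow> 'x) \<Rightarrow> bool"
  where "is_outer_frame act ip v \<longleftrightarrow>
    range v \<subseteq> multiplier_module ip \<and> (\<exists>n. v n \<notin> range (mult_embed act)) \<and>
    (\<exists>A B. frame_bounds ip v A B)"

text \<open>A frame is regarded as a sequence in the multiplier module through the embedding.\<close>

definition frame_or_outer_frame ::
    "('x \<Rightarrow> 'a \<Rightarrow> 'x) \<Rightarrow> ('x \<Rightarrow> 'x \<Rightarrow> 'a::cstar_algebra) \<Rightarrow> (nat \<Rightarrow> 'a \<Rightarrow> 'x) \<Rightarrow> bool"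
  where "frame_or_outer_frame act ip v \<longleftrightarrow>
    (\<exists>f. is_frame ip f \<and> v = (\<lambda>n. mult_embed act (f n))) \<or> is_outer_frame act ip v"

text \<open>The largest lower bound exists as soon as \<open>X \<noteq> 0\<close>.\<close>

definition optimal_lower_bound ::
    "('x \<Rightarrow> 'x \<Rightarrow> 'a::cstar_algebra) \<Rightarrow> (nat \<Rightarrow> 'a \<Rightarrow> 'x) \<Rightarrow> real"
  where "optimal_lower_bound ip v = (GREATEST A. \<exists>B. frame_bounds ip v A B)"

definition analysis_operator ::
    "('x \<Rightarrow> 'x \<Rightarrow> 'a::cstar_algebra) \<Rightarrow> (nat \<Rightarrow> 'a \<Rightarrow> 'x) \<Rightarrow> 'x \<Rightarrow> nat \<Rightarrow> 'a"
  where "analysis_operator ip v x = (\<lambda>n. mult_pairing ip (v n) x)"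

context hilbert_module
begin

lemma is_frame_iff:
  "is_frame ip f \<longleftrightarrow> (\<exists>A B. frame_bounds ip (\<lambda>n. mult_embed act (f n)) A B)"
  unfolding is_frame_def frame_bounds_def mult_pairing_embed star_ip by blast

lemma analysis_operator_embed:
  "analysis_operator ip (\<lambda>n. mult_embed act (f n)) x = (\<lambda>n. ip (f n) x)"
  by (simp add: analysis_operator_def mult_pairing_embed)

end

end

theory Submission
  imports Defs
begin

text \<open>Write \<open>D = U - V\<close> and \<open>M\<close> for its norm. For \<open>t > 0\<close>,
  \<open>\<langle>Uz, Uz\<rangle> \<le> (1 + t) \<langle>Vz, Vz\<rangle> + (1 + 1/t) \<langle>Dz, Dz\<rangle>\<close>, and \<open>\<langle>Dz, Dz\<rangle> \<le> M\<^sup>2 \<langle>z, z\<rangle>\<close> since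
  \<open>D\<close> is a bounded module map; as \<open>M\<^sup>2 < A\<close>, a large \<open>t\<close> yields a lower frame bound for \<open>V\<close>. Neither
  inequality needs an adjoint of \<open>U\<close>. The members of the new frame are \<open>y\<^sub>n = V\<^sup>* e\<^sub>n\<close>, and \<open>V\<close> is
  bounded by the uniform boundedness principle. The order theory of a C*-algebra, up to Kaplansky's
  theorem that every \<open>c\<^sup>*c\<close> is positive, is obtained in the unitization without spectral theory: from
  square roots built by iteration and from the growth of the powers of self-adjoint elements.\<close>

subsection \<open>The involution\<close>

text \<open>Since \<open>\<le>\<^sub>C\<close> only asserts that some \<open>star c * c\<close>
  exists, its transitivity and the monotonicity of the norm are already theorems. Sums and limits of
  positive elements are easy for the norm description \<open>cpos\<close>, conjugation is easy for
  \<open>star c * c\<close>, so the two descriptions must be joined before either can be used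
  freely. The unit is needed twice: for roots of \<open>1 - h\<close>, and because the test elements
  that turn norm inequalities into order inequalities are inverses of invertible elements.
  Boundedness of D is an obstacle of its own: \<open>adjointable\<close> does not contain it, and
  \<open>onorm_ell2\<close> is a real supremum, which bounds nothing until the set is known to be
  bounded. For U the upper frame bound suffices; for V the completeness of the module has to be
  exploited. The strict inequality M^2 < A is exactly the room needed for (1 + 1/t) M^2 < A, the
  factor 1 + t on the side of V being harmless. The zero module stands apart: there every positive
  constant is a lower bound and no optimal one is determined.\<close>

lemma scaleC_scaleR: "c *\<^sub>C r *\<^sub>R x = r *\<^sub>R c *\<^sub>C (x::'a::complex_vector)"
  by (metis scaleC_of_real scaleC_scaleC mult.commute)

lemma scaleR_scaleC: "(r *\<^sub>R c) *\<^sub>C x = r *\<^sub>R c *\<^sub>C (x::'a::complex_vector)"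
  by (simp add: scaleR_conv_of_real scaleC_scaleC[symmetric] scaleC_of_real)

lemma scaleC_zero_left [simp]: "0 *\<^sub>C (x::'a::complex_vector) = 0"
  using scaleC_of_real[of 0 x] by simp

lemma scaleC_one [simp]: "1 *\<^sub>C (x::'a::complex_vector) = x"
  using scaleC_of_real[of 1 x] by simp

lemma scaleC_zero_right [simp]: "c *\<^sub>C (0::'a::complex_vector) = 0"
  using scaleC_add_right[of c 0 "0::'a"] by simp

lemma scaleC_minus_left: "(- c) *\<^sub>C (x::'a::complex_vector) = - (c *\<^sub>C x)"
  using scaleC_add_left[of c "- c" x] by (simp add: eq_neg_iff_add_eq_0 add.commute)

lemma scaleC_minus_right: "c *\<^sub>C (- (x::'a::complex_vector)) = - (c *\<^sub>C x)"
  using scaleC_add_right[of c x "- x"] by (simp add: eq_neg_iff_add_eq_0 add.commute)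

lemma scaleC_diff_right: "c *\<^sub>C (x - y) = c *\<^sub>C x - c *\<^sub>C (y::'a::complex_vector)"
  using scaleC_add_right[of c x "- y"] by (simp add: scaleC_minus_right)

lemma bounded_linear_scaleC_right: "bounded_linear (\<lambda>x::'a::complex_normed_vector. c *\<^sub>C x)"
  by (rule bounded_linear_intro[where K = "cmod c"])
    (simp_all add: scaleC_add_right scaleC_scaleR norm_scaleC mult.commute)

lemma star_zero [simp]: "star (0::'a::cstar_algebra) = 0"
  using star_add[of 0 "0::'a"] by simp

lemma star_minus: "star (- a) = - star (a::'a::cstar_algebra)"
  using star_add[of a "- a"] by (simp add: eq_neg_iff_add_eq_0 add.commute)

lemma star_diff: "star (a - b) = star a - star (b::'a::cstar_algebra)"
  using star_add[of a "- b"] by (simp add: star_minus)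

lemma star_scaleR: "star (r *\<^sub>R a) = r *\<^sub>R star (a::'a::cstar_algebra)"
  by (metis complex_cnj_complex_of_real scaleC_of_real star_scaleC)

lemma norm_star [simp]: "norm (star a) = norm (a::'a::cstar_algebra)"
proof -
  have le: "norm b \<le> norm (star b)" for b :: 'a
  proof (cases "b = 0")
    case False
    have "norm b * norm b \<le> norm (star b) * norm b"
      using norm_mult_ineq[of "star b" b] by (simp add: norm_star_mult_self power2_eq_square)
    then show ?thesis using False by simp
  qed simp
  from le[of a] le[of "star a"] show ?thesis by simp
qed

lemma bounded_linear_star: "bounded_linear (star :: 'a::cstar_algebra \<Rightarrow> 'a)"
  by (rule bounded_linear_intro[where K = 1]) (simp_all add: star_add star_scaleR)

lemma star_mult_self_eq_0_iff: "star a * a = 0 \<longleftrightarrow> (a::'a::cstar_algebra) = 0"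
  using norm_star_mult_self[of a] by auto

lemma star_one [simp]: "star (1::'a::{cstar_algebra,real_normed_algebra_1}) = 1"
  by (metis mult.left_neutral star_mult star_star mult_1_right)


subsection \<open>The unitization\<close>

text \<open>The maximum with the modulus of the scalar part makes the norm definite also when the
  algebra already has a unit.\<close>

datatype 'a unitization = Unitize (alg_part: 'a) (scalar_part: complex)

text \<open>The algebra is an ideal of its unitization, which acts on it by left multiplication. The
  operator norm of this action is what yields the C*-identity; the sum of the norms of the two parts
  would not.\<close>

definition unitization_act :: "'a::cstar_algebra unitization \<Rightarrow> 'a \<Rightarrow> 'a"
  where "unitization_act u b = alg_part u * b + scalar_part u *\<^sub>C b"

lemma bounded_linear_unitization_act: "bounded_linear (unitization_act u)"
  unfolding unitization_act_def
  by (intro bounded_linear_add bounded_linear_mult_right bounded_linear_scaleC_right)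

instantiation unitization :: (cstar_algebra) "{complex_normed_vector, real_normed_algebra}"
begin

definition zero_unitization :: "'a unitization" where "0 = Unitize 0 0"
definition plus_unitization :: "'a unitization \<Rightarrow> 'a unitization \<Rightarrow> 'a unitization"
  where "u + v = Unitize (alg_part u + alg_part v) (scalar_part u + scalar_part v)"
definition uminus_unitization :: "'a unitization \<Rightarrow> 'a unitization"
  where "- u = Unitize (- alg_part u) (- scalar_part u)"
definition minus_unitization :: "'a unitization \<Rightarrow> 'a unitization \<Rightarrow> 'a unitization"
  where "u - v = Unitize (alg_part u - alg_part v) (scalar_part u - scalar_part v)"
definition scaleR_unitization :: "real \<Rightarrow> 'a unitization \<Rightarrow> 'a unitization"
  where "r *\<^sub>R u = Unitize (r *\<^sub>R alg_part u) (r *\<^sub>R scalar_part u)"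
definition scaleC_unitization :: "complex \<Rightarrow> 'a unitization \<Rightarrow> 'a unitization"
  where "c *\<^sub>C u = Unitize (c *\<^sub>C alg_part u) (c * scalar_part u)"
definition times_unitization :: "'a unitization \<Rightarrow> 'a unitization \<Rightarrow> 'a unitization"
  where "u * v = Unitize (alg_part u * alg_part v + scalar_part v *\<^sub>C alg_part u
    + scalar_part u *\<^sub>C alg_part v) (scalar_part u * scalar_part v)"
definition norm_unitization :: "'a unitization \<Rightarrow> real"
  where "norm u = max (onorm (unitization_act u)) (cmod (scalar_part u))"
definition sgn_unitization :: "'a unitization \<Rightarrow> 'a unitization"
  where "sgn_unitization u = scaleR (inverse (norm u)) u"
definition dist_unitization :: "'a unitization \<Rightarrow> 'a unitization \<Rightarrow> real"
  where "dist_unitization u v = norm (u - v)"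
definition uniformity_unitization :: "('a unitization \<times> 'a unitization) filter"
  where "uniformity_unitization = (INF e\<in>{0<..}. principal {(x, y). dist x (y::'a unitization) < e})"
definition open_unitization :: "'a unitization set \<Rightarrow> bool"
  where "open_unitization U = (\<forall>x\<in>U. eventually (\<lambda>(x', y). x' = x \<longrightarrow> y \<in> U) uniformity)"

lemmas unitization_simps = zero_unitization_def plus_unitization_def uminus_unitization_def
  minus_unitization_def scaleR_unitization_def scaleC_unitization_def times_unitization_def

lemma unitization_act_mult: "unitization_act (u * v) b = unitization_act u (unitization_act v b)"
  by (simp add: unitization_act_def times_unitization_def algebra_simps mult_scaleC_left
    mult_scaleC_right scaleC_add_left scaleC_add_right scaleC_scaleC)

lemma unitization_act_add: "unitization_act (u + v) b = unitization_act u b + unitization_act v b"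
  by (simp add: unitization_act_def plus_unitization_def algebra_simps scaleC_add_left)

lemma unitization_act_scaleC: "unitization_act (c *\<^sub>C u) b = c *\<^sub>C unitization_act u b"
  by (simp add: unitization_act_def scaleC_unitization_def algebra_simps scaleC_add_right
    mult_scaleC_left scaleC_scaleC)

lemma norm_unitization_act_le: "norm (unitization_act u b) \<le> norm u * norm b"
proof -
  have "norm (unitization_act u b) \<le> onorm (unitization_act u) * norm b"
    by (rule onorm[OF bounded_linear_unitization_act])
  also have "\<dots> \<le> norm u * norm b"
    by (rule mult_right_mono) (simp_all add: norm_unitization_def)
  finally show ?thesis .
qed

lemma cmod_scalar_part_le: "cmod (scalar_part u) \<le> norm u"
  by (simp add: norm_unitization_def)

lemma norm_unitization_le:
  assumes "\<And>b. norm (unitization_act u b) \<le> K * norm b" "cmod (scalar_part u) \<le> K"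
  shows "norm u \<le> K"
  using onorm_bound[of K "unitization_act u"] assms order_trans[OF norm_ge_zero assms(2)]
  by (simp add: norm_unitization_def)

lemma norm_unitization_nonneg: "0 \<le> norm (u::'a unitization)"
  using norm_ge_zero[of "scalar_part u"] cmod_scalar_part_le[of u] by linarith

text \<open>Test the action on \<open>star (alg_part u)\<close>: the product with
  \<open>alg_part u\<close> has norm \<open>norm (alg_part u)\<close> squared and is the action of
  \<open>u\<close> minus a scalar multiple, each contributing one \<open>norm u\<close>. This gives
  definiteness and completeness.\<close>

lemma norm_alg_part_le: "norm (alg_part u) \<le> 2 * norm u"
proof (cases "alg_part u = 0")
  case False
  let ?a = "alg_part u" and ?b = "star (alg_part u)"
  have "norm ?a * norm ?a = norm (?a * ?b)"
    using norm_star_mult_self[of ?b] by (simp add: power2_eq_square)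
  also have "?a * ?b = unitization_act u ?b - scalar_part u *\<^sub>C ?b"
    by (simp add: unitization_act_def)
  also have "norm \<dots> \<le> norm u * norm ?a + norm u * norm ?a"
    using norm_triangle_ineq4[of "unitization_act u ?b" "scalar_part u *\<^sub>C ?b"]
      norm_unitization_act_le[of u ?b] mult_right_mono[OF cmod_scalar_part_le[of u], of "norm ?a"]
    by (simp add: norm_scaleC)
  finally have "norm ?a * norm ?a \<le> (2 * norm u) * norm ?a"
    by (simp add: algebra_simps)
  then show ?thesis using False by simp
qed (simp add: norm_unitization_nonneg)

lemma norm_unitization_triangle: "norm (u + v) \<le> norm u + norm (v::'a unitization)"
proof (rule norm_unitization_le)
  fix b
  show "norm (unitization_act (u + v) b) \<le> (norm u + norm v) * norm b"
    using norm_triangle_ineq[of "unitization_act u b" "unitization_act v b"]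
      norm_unitization_act_le[of u b] norm_unitization_act_le[of v b]
    by (simp add: unitization_act_add algebra_simps)
next
  show "cmod (scalar_part (u + v)) \<le> norm u + norm v"
    using norm_triangle_ineq[of "scalar_part u" "scalar_part v"]
      cmod_scalar_part_le[of u] cmod_scalar_part_le[of v]
    by (simp add: plus_unitization_def)
qed

lemma norm_unitization_scaleC_le: "norm (c *\<^sub>C u) \<le> cmod c * norm (u::'a unitization)"
proof (rule norm_unitization_le)
  fix b
  show "norm (unitization_act (c *\<^sub>C u) b) \<le> (cmod c * norm u) * norm b"
    using norm_unitization_act_le[of u b]
    by (simp add: unitization_act_scaleC norm_scaleC mult.assoc mult_left_mono)
next
  show "cmod (scalar_part (c *\<^sub>C u)) \<le> cmod c * norm u"
    by (simp add: scaleC_unitization_def norm_mult mult_left_mono cmod_scalar_part_le)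
qed

lemma norm_unitization_scaleC: "norm (c *\<^sub>C u) = cmod c * norm (u::'a unitization)"
proof (cases "c = 0")
  case True
  then show ?thesis
    using norm_unitization_scaleC_le[of c u] norm_unitization_nonneg[of "c *\<^sub>C u"] by simp
next
  case False
  then have "u = inverse c *\<^sub>C c *\<^sub>C u"
    by (cases u) (simp add: scaleC_unitization_def scaleC_scaleC)
  then have "norm u \<le> cmod (inverse c) * norm (c *\<^sub>C u)"
    using norm_unitization_scaleC_le[of "inverse c" "c *\<^sub>C u"] by simp
  then have "cmod c * norm u \<le> cmod c * (inverse (cmod c) * norm (c *\<^sub>C u))"
    by (intro mult_left_mono) (simp_all add: norm_inverse)
  also have "\<dots> = norm (c *\<^sub>C u)" using False by simp
  finally have "cmod c * norm u \<le> norm (c *\<^sub>C u)" .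
  then show ?thesis
    using norm_unitization_scaleC_le[of c u] False by simp
qed

lemma scaleC_of_real_unitization: "complex_of_real r *\<^sub>C u = r *\<^sub>R (u::'a unitization)"
  by (simp add: scaleC_unitization_def scaleR_unitization_def scaleC_of_real scaleR_conv_of_real)

lemma norm_unitization_mult: "norm (u * v) \<le> norm u * norm (v::'a unitization)"
proof (rule norm_unitization_le)
  fix b
  show "norm (unitization_act (u * v) b) \<le> (norm u * norm v) * norm b"
    using norm_unitization_act_le[of u "unitization_act v b"] 
      mult_left_mono[OF norm_unitization_act_le[of v b] norm_unitization_nonneg[of u]]
    by (simp add: unitization_act_mult mult.assoc)
next
  show "cmod (scalar_part (u * v)) \<le> norm u * norm v"
    by (simp add: times_unitization_def norm_mult mult_mono cmod_scalar_part_le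
      norm_unitization_nonneg)
qed

instance
proof
  fix u v w :: "'a unitization" and r s :: real and c d :: complex
  show norm0: "norm u = 0 \<longleftrightarrow> u = 0"
  proof
    assume "norm u = 0"
    then show "u = 0"
      using norm_alg_part_le[of u] cmod_scalar_part_le[of u]
      by (simp add: zero_unitization_def unitization.expand)
  next
    assume "u = 0"
    then have "unitization_act u = (\<lambda>b. 0)" "scalar_part u = 0"
      by (simp_all add: fun_eq_iff zero_unitization_def unitization_act_def)
    then show "norm u = 0"
      by (simp add: norm_unitization_def onorm_zero)
  qed
  show "norm (u + v) \<le> norm u + norm v" by (rule norm_unitization_triangle)
  show "norm (u * v) \<le> norm u * norm v" by (rule norm_unitization_mult)
  show "norm (c *\<^sub>C u) = cmod c * norm u" by (rule norm_unitization_scaleC)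
  show "norm (r *\<^sub>R u) = \<bar>r\<bar> * norm u"
    using norm_unitization_scaleC[of "complex_of_real r" u] by (simp add: scaleC_of_real_unitization)
  show "complex_of_real r *\<^sub>C u = r *\<^sub>R u" by (rule scaleC_of_real_unitization)
qed (auto simp: unitization_simps sgn_unitization_def dist_unitization_def
  uniformity_unitization_def open_unitization_def algebra_simps mult_scaleC_left mult_scaleC_right
  scaleC_add_left scaleC_add_right scaleC_scaleC scaleC_scaleR scaleR_scaleC scaleC_minus_left
  intro: unitization.expand)

end

text \<open>The norm is equivalent to the sum of the norms of the two parts, so limits can be taken
  in each part.\<close>

instance unitization :: (cstar_algebra) banach
proof
  fix X :: "nat \<Rightarrow> 'a unitization"
  assume cauchy: "Cauchy X"
  show "convergent X"
  proof -
    have d: "norm (alg_part (X m) - alg_part (X n)) \<le> 2 * dist (X m) (X n)"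
      "norm (scalar_part (X m) - scalar_part (X n)) \<le> dist (X m) (X n)" for m n
      using norm_alg_part_le[of "X m - X n"] cmod_scalar_part_le[of "X m - X n"]
      by (simp_all add: dist_unitization_def minus_unitization_def)
    have "Cauchy (\<lambda>n. alg_part (X n))"
    proof (rule metric_CauchyI)
      fix e :: real assume "e > 0"
      then obtain M where M: "\<forall>m\<ge>M. \<forall>n\<ge>M. dist (X m) (X n) < e / 2"
        using metric_CauchyD[OF cauchy, of "e / 2"] by auto
      have "dist (alg_part (X m)) (alg_part (X n)) < e" if "m \<ge> M" "n \<ge> M" for m n
        using d(1)[of m n] M that by (fastforce simp: dist_norm[where 'a='a])
      then show "\<exists>M. \<forall>m\<ge>M. \<forall>n\<ge>M. dist (alg_part (X m)) (alg_part (X n)) < e"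
        by blast
    qed
    then obtain a where a: "(\<lambda>n. alg_part (X n)) \<longlonglongrightarrow> a"
      by (auto simp: Cauchy_convergent_iff convergent_def)
    have "Cauchy (\<lambda>n. scalar_part (X n))"
      using cauchy d(2) unfolding Cauchy_def dist_norm[where 'a=complex] by (meson le_less_trans)
    then obtain l where l: "(\<lambda>n. scalar_part (X n)) \<longlonglongrightarrow> l"
      by (auto simp: Cauchy_convergent_iff convergent_def)
    have le: "norm (u - v) \<le> norm (alg_part u - alg_part v) + norm (scalar_part u - scalar_part v)"
      for u v :: "'a unitization"
    proof (rule norm_unitization_le)
      fix b
      have "norm ((alg_part u - alg_part v) * b) \<le> norm (alg_part u - alg_part v) * norm b"
        by (rule norm_mult_ineq)
      then show "norm (unitization_act (u - v) b)
        \<le> (norm (alg_part u - alg_part v) + norm (scalar_part u - scalar_part v)) * norm b"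
        using norm_triangle_ineq[of "(alg_part u - alg_part v) * b" "(scalar_part u - scalar_part v) *\<^sub>C b"]
        by (simp add: unitization_act_def minus_unitization_def norm_scaleC distrib_right)
    qed (simp add: minus_unitization_def)
    have "(\<lambda>n. norm (alg_part (X n) - a) + norm (scalar_part (X n) - l)) \<longlonglongrightarrow> 0"
      using a l by (intro tendsto_add_zero) (simp_all add: LIM_zero_iff tendsto_norm_zero_iff)
    then have "(\<lambda>n. X n - Unitize a l) \<longlonglongrightarrow> 0"
      by (rule Lim_null_comparison[rotated])
        (use le[of _ "Unitize a l"] in \<open>simp add: always_eventually\<close>)
    then have "X \<longlonglongrightarrow> Unitize a l"
      by (simp add: LIM_zero_iff)
    then show ?thesis by (auto simp: convergent_def)
  qed
qed

instantiation unitization :: (cstar_algebra) cstar_algebra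
begin

definition star_unitization :: "'a unitization \<Rightarrow> 'a unitization"
  where "star u = Unitize (star (alg_part u)) (cnj (scalar_part u))"

text \<open>The action of \<open>star u\<close> is adjoint to that of \<open>u\<close> for the form
  \<open>star a * b\<close>. The C*-identity then follows as for operators on a Hilbert
  space.\<close>

lemma unitization_act_star:
  "star a * unitization_act u b = star (unitization_act (star u) a) * b"
  by (simp add: unitization_act_def star_unitization_def algebra_simps mult_scaleC_left
    mult_scaleC_right star_add star_mult star_scaleC)

lemma norm_unitization_star_mult_ge: "(norm u)\<^sup>2 \<le> norm (star u * (u::'a unitization))"
proof -
  let ?K = "norm (star u * u)"
  have "norm u \<le> sqrt ?K"
  proof (rule norm_unitization_le)
    fix b
    have "(norm (unitization_act u b))\<^sup>2 = norm (star b * unitization_act (star u * u) b)"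
      unfolding norm_star_mult_self[symmetric]
      by (simp add: unitization_act_mult unitization_act_star star_unitization_def)
    also have "\<dots> \<le> norm b * (?K * norm b)"
      using norm_mult_ineq[of "star b" "unitization_act (star u * u) b"]
        mult_left_mono[OF norm_unitization_act_le[of "star u * u" b], of "norm b"] by simp
    also have "\<dots> = (sqrt ?K * norm b)\<^sup>2"
      by (simp add: power_mult_distrib norm_unitization_nonneg power2_eq_square)
    finally show "norm (unitization_act u b) \<le> sqrt ?K * norm b"
      by (rule power2_le_imp_le) (simp add: norm_unitization_nonneg)
  next
    have "(cmod (scalar_part u))\<^sup>2 \<le> ?K"
      using cmod_scalar_part_le[of "star u * u"]
      by (simp add: times_unitization_def star_unitization_def norm_mult power2_eq_square)
    then show "cmod (scalar_part u) \<le> sqrt ?K"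
      by (rule real_le_rsqrt)
  qed
  then have "(norm u)\<^sup>2 \<le> (sqrt ?K)\<^sup>2"
    by (rule power_mono) (simp add: norm_unitization_nonneg)
  then show ?thesis by (simp add: norm_unitization_nonneg)
qed

instance
proof
  fix u v :: "'a unitization" and c :: complex
  have star_le: "norm (star u) \<le> norm u" for u :: "'a unitization"
  proof (cases "norm (star u) = 0")
    case True
    then show ?thesis by (simp add: norm_unitization_nonneg)
  next
    case False
    have ss: "star (star u) = u" by (simp add: star_unitization_def)
    have "norm (star u) * norm (star u) \<le> norm u * norm (star u)"
      using norm_unitization_star_mult_ge[of "star u"] norm_unitization_mult[of u "star u"] ss
      by (simp add: power2_eq_square)
    then show ?thesis using False norm_unitization_nonneg[of "star u"] by simp
  qed
  have "norm (star u * u) \<le> norm u * norm u"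
    using norm_unitization_mult[of "star u" u] mult_right_mono[OF star_le[of u] norm_unitization_nonneg[of u]]
    by linarith
  then show "norm (star u * u) = (norm u)\<^sup>2"
    using norm_unitization_star_mult_ge[of u] by (simp add: power2_eq_square)
qed (simp_all add: unitization_simps star_unitization_def algebra_simps mult_scaleC_left mult_scaleC_right
  scaleC_add_right scaleC_scaleC star_add star_mult star_scaleC)

end

instantiation unitization :: (cstar_algebra) real_normed_algebra_1
begin

definition one_unitization :: "'a unitization" where "1 = Unitize 0 1"

instance
proof
  \<comment> \<open>The scalar part forces equality even over the zero algebra, where the operator
    norm of the identity is 0.\<close>
  show "norm (1::'a unitization) = 1"
    using onorm_id_le[where 'a='a]
    by (simp add: norm_unitization_def one_unitization_def unitization_act_def[abs_def])
qed (auto simp: one_unitization_def unitization_simps intro: unitization.expand)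

end


subsection \<open>Square roots in unital C*-algebras\<close>

text \<open>With \<open>r = 1 - s\<close>, the equation \<open>r\<^sup>2 = 1 - h\<close> is the fixed point equation
  \<open>s = (h + s\<^sup>2) / 2\<close>. The iteration from \<open>0\<close> is dominated by the scalar one for \<open>h = 1\<close>, whose
  increments are summable; this covers the boundary case \<open>norm h = 1\<close>.\<close>

primrec sqrt_iter :: "'b::real_normed_algebra \<Rightarrow> nat \<Rightarrow> 'b"
  where "sqrt_iter h 0 = 0"
  | "sqrt_iter h (Suc n) = (1/2) *\<^sub>R (h + sqrt_iter h n * sqrt_iter h n)"

text \<open>The iterates are polynomials in \<open>h\<close>. The property survives the limit, and
  square roots that commute with whatever commutes with their square take the place of a functional
  calculus below.\<close>

lemma sqrt_iter_commute: "b * h = h * b \<Longrightarrow> b * sqrt_iter h n = sqrt_iter h n * b"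
proof (induction n)
  case (Suc n)
  then have "b * (sqrt_iter h n * sqrt_iter h n) = (sqrt_iter h n * sqrt_iter h n) * b"
    by (metis mult.assoc)
  with Suc.prems show ?case by (simp add: distrib_left distrib_right)
qed simp

lemma star_sqrt_iter: "star h = h \<Longrightarrow> star (sqrt_iter h n) = sqrt_iter h (n::nat)"
  for h :: "'b::cstar_algebra"
  by (induction n) (simp_all add: star_scaleR star_add star_mult)

text \<open>The map t -> (1 + t^2)/2 is increasing on [0,1] and fixes 1.\<close>

lemma sqrt_iter_one_bounds:
  "0 \<le> sqrt_iter (1::real) n \<and> sqrt_iter (1::real) n \<le> sqrt_iter 1 (Suc n) \<and> sqrt_iter 1 (Suc n) \<le> (1::real)"
proof (induction n)
  case (Suc n)
  let ?t = "sqrt_iter (1::real)"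
  have eq: "?t (Suc n) = (1 + ?t n * ?t n) / 2" "?t (Suc (Suc n)) = (1 + ?t (Suc n) * ?t (Suc n)) / 2"
    by simp_all
  from Suc have "0 \<le> ?t (Suc n)" by linarith
  moreover from Suc have "?t n * ?t n \<le> ?t (Suc n) * ?t (Suc n)"
    by (intro mult_mono) linarith+
  then have "?t (Suc n) \<le> ?t (Suc (Suc n))"
    unfolding eq(2) by (subst eq(1)) (simp del: sqrt_iter.simps)
  moreover have "?t (Suc n) * ?t (Suc n) \<le> 1 * 1"
    using Suc \<open>0 \<le> ?t (Suc n)\<close> by (intro mult_mono) linarith+
  then have "?t (Suc (Suc n)) \<le> 1"
    unfolding eq(2) by (simp del: sqrt_iter.simps)
  ultimately show ?case by blast
qed simp

text \<open>As the iterates commute, each increment is half the product of the sum and the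
  difference of the two preceding iterates. The scalar iteration obeys the same recursion, so the
  estimates propagate together.\<close>

lemma sqrt_iter_dominated:
  fixes h :: "'b::real_normed_algebra"
  assumes "norm h \<le> 1"
  shows "norm (sqrt_iter h n) \<le> sqrt_iter 1 n
    \<and> norm (sqrt_iter h (Suc n) - sqrt_iter h n) \<le> sqrt_iter 1 (Suc n) - (sqrt_iter 1 n :: real)"
proof (induction n)
  case 0
  then show ?case using assms by simp
next
  case (Suc n)
  let ?s = "sqrt_iter h" and ?t = "sqrt_iter (1::real)"
  have 1: "norm (?s (Suc n)) \<le> ?t (Suc n)"
  proof -
    have "norm (?s n * ?s n) \<le> ?t n * ?t n"
      using Suc by (intro order_trans[OF norm_mult_ineq] mult_mono) (use sqrt_iter_one_bounds[of n] in auto)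
    then have "norm (h + ?s n * ?s n) \<le> 1 + ?t n * ?t n"
      using assms norm_triangle_ineq[of h "?s n * ?s n"] by linarith
    then show ?thesis by simp
  qed
  \<comment> \<open>Commutation is used twice: iterates commute with \<open>h\<close>, hence with
    every other iterate.\<close>
  have "h * ?s k = ?s k * h" for k
    by (rule sqrt_iter_commute) simp
  then have "?s n * h = h * ?s n" by simp
  then have c: "?s n * ?s (Suc n) = ?s (Suc n) * ?s n"
    by (rule sqrt_iter_commute)
  have "?s (Suc (Suc n)) - ?s (Suc n) = (1/2) *\<^sub>R (?s (Suc n) * ?s (Suc n) - ?s n * ?s n)"
    unfolding sqrt_iter.simps(2)[of h "Suc n"] sqrt_iter.simps(2)[of h n, THEN arg_cong[where f = "\<lambda>z. _ - z"]]
    by (simp only: scaleR_diff_right[symmetric] scaleR_add_right) (simp add: algebra_simps)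
  also have "?s (Suc n) * ?s (Suc n) - ?s n * ?s n = (?s (Suc n) + ?s n) * (?s (Suc n) - ?s n)"
    using c by (simp add: distrib_right right_diff_distrib del: sqrt_iter.simps)
  also have "norm ((1/2) *\<^sub>R \<dots>) = norm ((?s (Suc n) + ?s n) * (?s (Suc n) - ?s n)) / 2"
    by (simp del: sqrt_iter.simps)
  also have "\<dots> \<le> (?t (Suc n) + ?t n) * (?t (Suc n) - ?t n) / 2"
  proof -
    have "norm (?s (Suc n) + ?s n) \<le> ?t (Suc n) + ?t n"
      using 1 Suc norm_triangle_ineq[of "?s (Suc n)" "?s n"] by linarith
    then have "norm (?s (Suc n) + ?s n) * norm (?s (Suc n) - ?s n) \<le> (?t (Suc n) + ?t n) * (?t (Suc n) - ?t n)"
      using Suc by (intro mult_mono) (use sqrt_iter_one_bounds[of n] in auto)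
    then show ?thesis
      using norm_mult_ineq[of "?s (Suc n) + ?s n" "?s (Suc n) - ?s n"] by linarith
  qed
  also have "\<dots> = ?t (Suc (Suc n)) - ?t (Suc n)"
  proof -
    have "?t (Suc n) = (1 + ?t n * ?t n) / 2" "?t (Suc (Suc n)) = (1 + ?t (Suc n) * ?t (Suc n)) / 2"
      by simp_all
    then show ?thesis by (simp add: field_simps del: sqrt_iter.simps)
  qed
  finally show ?case using 1 by blast
qed

text \<open>The equation is (1 - s)^2 = 1 - h written without a unit. The increments are summable in
  norm, and their partial sums telescope to the iterates.\<close>

lemma quasi_sqrt_exists:
  fixes h :: "'b::{real_normed_algebra, banach}"
  assumes "norm h \<le> 1"
  obtains s where "2 *\<^sub>R s - s * s = h" "norm s \<le> 1" "sqrt_iter h \<longlonglongrightarrow> s"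
proof -
  let ?t = "sqrt_iter (1::real)"
  have "incseq ?t" using sqrt_iter_one_bounds by (intro incseq_SucI) blast
  moreover have le1: "?t n \<le> 1" for n
    using sqrt_iter_one_bounds[of n] by linarith
  ultimately have "convergent ?t"
    by (intro Bseq_monoseq_convergent incseq_imp_monoseq BseqI'[of _ 1])
      (use sqrt_iter_one_bounds in \<open>auto simp del: sqrt_iter.simps\<close>)
  then have "summable (\<lambda>n. ?t (Suc n) - ?t n)"
    using telescope_summable by (auto simp: convergent_def simp del: sqrt_iter.simps)
  then have "summable (\<lambda>n. sqrt_iter h (Suc n) - sqrt_iter h n)"
    by (rule summable_comparison_test'[where N = 0]) (use sqrt_iter_dominated[OF assms] in blast)
  then have "convergent (\<lambda>n. \<Sum>k<n. sqrt_iter h (Suc k) - sqrt_iter h k)"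
    by (rule summable_iff_convergent[THEN iffD1])
  moreover have "(\<Sum>k<n. sqrt_iter h (Suc k) - sqrt_iter h k) = sqrt_iter h n" for n
    using sum_lessThan_telescope[of "sqrt_iter h" n] by simp
  ultimately obtain s where s: "sqrt_iter h \<longlonglongrightarrow> s"
    by (auto simp: convergent_def simp del: sqrt_iter.simps)
  have "(\<lambda>n. (1/2) *\<^sub>R (h + sqrt_iter h n * sqrt_iter h n)) \<longlonglongrightarrow> (1/2) *\<^sub>R (h + s * s)"
    by (intro tendsto_intros s)
  then have "sqrt_iter h \<longlonglongrightarrow> (1/2) *\<^sub>R (h + s * s)"
    using filterlim_sequentially_Suc[of "sqrt_iter h"] by simp
  then have "s = (1/2) *\<^sub>R (h + s * s)"
    using s LIMSEQ_unique by blast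
  then have "2 *\<^sub>R s = 2 *\<^sub>R (1/2) *\<^sub>R (h + s * s)"
    by simp
  then have "2 *\<^sub>R s - s * s = h"
    by simp
  moreover have "norm s \<le> 1"
    by (rule Lim_bounded[OF tendsto_norm[OF s], of 0])
      (use sqrt_iter_dominated[OF assms] le1 in \<open>blast intro: order_trans\<close>)
  ultimately show thesis using s that by blast
qed

text \<open>Self-adjointness and commutation are inherited from the iterates. The bound on
  \<open>1 - r\<close> is what later makes the root itself positive.\<close>

lemma sqrt_one_minus_exists:
  fixes h :: "'b::{cstar_algebra, real_normed_algebra_1}"
  assumes "norm h \<le> 1" "star h = h"
  obtains r where "r * r = 1 - h" "star r = r" "norm (1 - r) \<le> 1"
    "\<And>b. b * h = h * b \<Longrightarrow> b * r = r * b"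
proof -
  obtain s where s: "2 *\<^sub>R s - s * s = h" "norm s \<le> 1" "sqrt_iter h \<longlonglongrightarrow> s"
    using quasi_sqrt_exists[OF assms(1)] by blast
  show thesis
  proof (rule that[of "1 - s"])
    show "(1 - s) * (1 - s) = 1 - h"
      unfolding s(1)[symmetric] by (simp add: algebra_simps scaleR_2)
    have "(\<lambda>n. star (sqrt_iter h n)) \<longlonglongrightarrow> star s"
      by (rule bounded_linear.tendsto[OF bounded_linear_star s(3)])
    then have "sqrt_iter h \<longlonglongrightarrow> star s"
      by (simp add: star_sqrt_iter[OF assms(2)])
    then show "star (1 - s) = 1 - s"
      using s(3) LIMSEQ_unique by (auto simp: star_diff)
    show "b * (1 - s) = (1 - s) * b" if "b * h = h * b" for b
    proof -
      have "(\<lambda>n. b * sqrt_iter h n) \<longlonglongrightarrow> b * s" "(\<lambda>n. sqrt_iter h n * b) \<longlonglongrightarrow> s * b"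
        by (intro tendsto_intros s(3))+
      then have "b * s = s * b"
        using LIMSEQ_unique by (simp add: sqrt_iter_commute[OF that])
      then show ?thesis by (simp add: algebra_simps)
    qed
  qed (use s in simp)
qed


subsection \<open>Positive elements of unital C*-algebras\<close>

text \<open>The spectral notion of positivity, expressed through the norm.\<close>

definition cpos :: "'b::{cstar_algebra, real_normed_algebra_1} \<Rightarrow> bool"
  where "cpos a \<longleftrightarrow> star a = a \<and> (\<exists>K\<ge>0. norm (K *\<^sub>R 1 - a) \<le> K)"

lemma cposI: "star a = a \<Longrightarrow> norm (K *\<^sub>R 1 - a) \<le> K \<Longrightarrow> cpos a"
  unfolding cpos_def by (metis norm_ge_zero order_trans)

lemma cpos_star: "cpos a \<Longrightarrow> star a = a"
  by (simp add: cpos_def)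

lemma cpos_shift:
  fixes a :: "'b::{cstar_algebra, real_normed_algebra_1}"
  assumes "norm (K *\<^sub>R 1 - a) \<le> K" "K \<le> L"
  shows "norm (L *\<^sub>R 1 - a) \<le> L"
proof -
  have "L *\<^sub>R 1 - a = (L - K) *\<^sub>R 1 + (K *\<^sub>R 1 - a)"
    by (simp add: algebra_simps)
  then have "norm (L *\<^sub>R 1 - a) \<le> norm ((L - K) *\<^sub>R (1::'b)) + norm (K *\<^sub>R 1 - a)"
    by (simp only: norm_triangle_ineq)
  then show ?thesis using assms by simp
qed

lemma cpos_zero [simp]: "cpos 0"
  by (auto simp: cpos_def intro!: exI[of _ 0])

text \<open>Here the norm description pays off: the witnesses add up by the triangle inequality,
  while a sum of two elements \<open>star c * c\<close> is not visibly of that form.\<close>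

lemma cpos_add: assumes "cpos a" "cpos b" shows "cpos (a + b)"
proof -
  obtain K L where KL: "norm (K *\<^sub>R 1 - a) \<le> K" "0 \<le> K" "norm (L *\<^sub>R 1 - b) \<le> L" "0 \<le> L"
    using assms by (auto simp: cpos_def)
  have "norm ((K + L) *\<^sub>R 1 - (a + b)) \<le> K + L"
    using norm_triangle_ineq[of "K *\<^sub>R 1 - a" "L *\<^sub>R 1 - b"] KL by (simp add: algebra_simps)
  then show ?thesis
    using assms by (intro cposI[of _ "K + L"]) (simp_all add: cpos_star star_add)
qed

lemma cpos_scaleR: assumes "cpos a" "0 \<le> r" shows "cpos (r *\<^sub>R a)"
proof -
  obtain K where K: "norm (K *\<^sub>R 1 - a) \<le> K" "0 \<le> K"
    using assms by (auto simp: cpos_def)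
  have "norm ((r * K) *\<^sub>R 1 - r *\<^sub>R a) = r * norm (K *\<^sub>R 1 - a)"
    using assms(2) by (metis abs_of_nonneg norm_scaleR scaleR_diff_right scaleR_scaleR)
  also have "\<dots> \<le> r * K"
    using K assms by (intro mult_left_mono)
  finally show ?thesis
    using assms by (intro cposI[of _ "r * K"]) (simp_all add: cpos_star star_scaleR)
qed

lemma cpos_norm_diff: assumes "star a = a" "norm a \<le> K" shows "cpos (K *\<^sub>R 1 - a)"
  using assms by (intro cposI[of _ K]) (simp_all add: star_diff star_scaleR)

text \<open>Rescaling writes \<open>a\<close> as K (1 - h) with \<open>norm h\<close> at most 1, the
  situation of the iteration.\<close>

lemma cpos_sqrt:
  assumes "cpos a"
  obtains r where "r * r = a" "star r = r" "cpos r" "\<And>b. b * a = a * b \<Longrightarrow> b * r = r * b"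
proof -
  obtain K0 where K0: "norm (K0 *\<^sub>R 1 - a) \<le> K0"
    using assms by (auto simp: cpos_def)
  \<comment> \<open>The witness becomes a divisor, so it is enlarged to be positive; larger
    constants remain witnesses.\<close>
  define K where "K = max K0 1"
  have K: "norm (K *\<^sub>R 1 - a) \<le> K" "K > 0"
    using cpos_shift[OF K0, of K] by (auto simp: K_def)
  define h where "h = (1 / K) *\<^sub>R (K *\<^sub>R 1 - a)"
  have "norm h = norm (K *\<^sub>R 1 - a) / K"
    using K(2) by (simp only: h_def norm_scaleR) simp
  then have h: "norm h \<le> 1" "star h = h"
    using K assms by (simp_all add: h_def star_scaleR star_diff cpos_def)
  have ha: "1 - h = (1 / K) *\<^sub>R a"
    using K by (simp add: h_def scaleR_diff_right)
  obtain r where r: "r * r = 1 - h" "star r = r" "norm (1 - r) \<le> 1"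
    "\<And>b. b * h = h * b \<Longrightarrow> b * r = r * b"
    using sqrt_one_minus_exists[OF h] by blast
  show thesis
  proof (rule that[of "sqrt K *\<^sub>R r"])
    show "(sqrt K *\<^sub>R r) * (sqrt K *\<^sub>R r) = a"
      using K r(1) ha by simp
    show "star (sqrt K *\<^sub>R r) = sqrt K *\<^sub>R r"
      by (simp add: star_scaleR r(2))
    have "cpos r" using r(2,3) by (intro cposI[of _ 1]) simp_all
    then show "cpos (sqrt K *\<^sub>R r)" using K by (intro cpos_scaleR) auto
    show "b * (sqrt K *\<^sub>R r) = (sqrt K *\<^sub>R r) * b" if "b * a = a * b" for b
    proof -
      have "b * h = h * b"
        using that by (simp add: h_def right_diff_distrib left_diff_distrib)
      then show ?thesis using r(4) by simp
    qed
  qed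
qed

text \<open>\<open>r + \<i>s\<close> is unitary.\<close>

lemma norm_le_one_of_squares:
  fixes r s :: "'b::{cstar_algebra, real_normed_algebra_1}"
  assumes "star r = r" "star s = s" "r * s = s * r" "r * r + s * s = 1"
  shows "norm r \<le> 1"
proof -
  define u where "u = r + \<i> *\<^sub>C s"
  have su: "star u = r - \<i> *\<^sub>C s"
    using assms by (simp add: u_def star_add star_scaleC scaleC_minus_left)
  have "star u * u = 1"
    unfolding su using assms
    by (simp add: u_def algebra_simps mult_scaleC_left mult_scaleC_right scaleC_scaleC
      scaleC_minus_left scaleC_diff_right)
  then have "norm u = 1"
    using norm_star_mult_self[of u] by (simp add: power2_eq_1_iff)
      (use norm_ge_zero[of u] in linarith)
  moreover have "r = (1/2) *\<^sub>R (u + star u)"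
    unfolding su by (simp add: u_def scaleR_2[symmetric])
  then have "norm r \<le> (norm u + norm (star u)) / 2"
    using norm_triangle_ineq[of u "star u"] by simp
  ultimately show ?thesis by simp
qed

lemma norm_square_selfadjoint: "star s = s \<Longrightarrow> norm (s * s) = (norm (s::'b::cstar_algebra))\<^sup>2"
  using norm_star_mult_self[of s] by simp

text \<open>Sine and cosine: a root r of \<open>1 - s * s\<close> commutes with s, and the squares
  add up to 1, so r is a contraction whose square is \<open>1 - s * s\<close>.\<close>

lemma norm_one_minus_square_le:
  fixes s :: "'b::{cstar_algebra, real_normed_algebra_1}"
  assumes "star s = s" "norm s \<le> 1"
  shows "norm (1 - s * s) \<le> 1"
proof -
  have 1: "norm (s * s) \<le> 1" "star (s * s) = s * s"
    using assms by (simp_all add: norm_square_selfadjoint star_mult power_le_one)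
  obtain r where r: "r * r = 1 - s * s" "star r = r" "\<And>b. b * (s * s) = (s * s) * b \<Longrightarrow> b * r = r * b"
    using sqrt_one_minus_exists[OF 1] by metis
  have "s * r = r * s" by (rule r(3)) (simp add: mult.assoc)
  then have "norm r \<le> 1"
    using assms r(1,2) by (intro norm_le_one_of_squares[of r s]) simp_all
  then show ?thesis
    using r(1) norm_square_selfadjoint[OF r(2)] by (simp add: power_le_one)
qed

text \<open>The witness hidden in \<open>cpos\<close> can be any K above the norm: the root of
  \<open>a\<close>, divided by the root of K, is a contraction, and one minus its square is again
  one. Such uniform witnesses make limits of positive elements positive.\<close>

lemma cpos_norm_le:
  assumes "cpos a" "norm a \<le> K"
  shows "norm (K *\<^sub>R 1 - a) \<le> K"
proof (cases "K = 0")
  case False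
  then have K: "K > 0" using assms(2) norm_ge_zero[of a] by linarith
  obtain r where r: "r * r = a" "star r = r"
    using cpos_sqrt[OF assms(1)] by blast
  define s where "s = (1 / sqrt K) *\<^sub>R r"
  have s: "star s = s" "s * s = (1 / K) *\<^sub>R a"
    using r K by (simp_all add: s_def star_scaleR)
  have "(norm s)\<^sup>2 \<le> 1"
    using norm_square_selfadjoint[OF s(1)] s(2) assms(2) K by (simp add: field_simps)
  then have "norm (1 - (1 / K) *\<^sub>R a) \<le> 1"
    using norm_one_minus_square_le[OF s(1)] s(2) by (simp add: power2_le_iff_abs_le power_le_one_iff)
  then have "K * norm (1 - (1 / K) *\<^sub>R a) \<le> K * 1"
    using K by (intro mult_left_mono) auto
  moreover have "K *\<^sub>R 1 - a = K *\<^sub>R (1 - (1 / K) *\<^sub>R a)"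
    using K by (simp add: scaleR_diff_right)
  ultimately show ?thesis using K by simp
qed (use assms in simp)

lemma cpos_of_square: assumes "star s = s" shows "cpos (s * s)"
proof (cases "s = 0")
  case False
  define t where "t = (1 / norm s) *\<^sub>R s"
  have "star t = t" "norm t \<le> 1" using assms by (simp_all add: t_def star_scaleR)
  from norm_one_minus_square_le[OF this] have "cpos (t * t)"
    using \<open>star t = t\<close> by (intro cposI[of _ 1]) (simp_all add: star_mult)
  then have "cpos ((norm s)\<^sup>2 *\<^sub>R (t * t))" by (rule cpos_scaleR) simp
  moreover have "(norm s)\<^sup>2 *\<^sub>R (t * t) = s * s"
    using False by (simp add: t_def power2_eq_square)
  ultimately show ?thesis by simp
qed simp

text \<open>The roots commute too, so the product is the square of the self-adjoint product of the
  roots.\<close>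

lemma cpos_mult_commuting:
  assumes "cpos a" "cpos b" "a * b = b * a"
  shows "cpos (a * b)"
proof -
  obtain r where r: "r * r = a" "star r = r" "\<And>c. c * a = a * c \<Longrightarrow> c * r = r * c"
    using cpos_sqrt[OF assms(1)] by metis
  obtain s where s: "s * s = b" "star s = s" "\<And>c. c * b = b * c \<Longrightarrow> c * s = s * c"
    using cpos_sqrt[OF assms(2)] by metis
  have "b * r = r * b" using assms(3) by (intro r(3)) simp
  then have rs: "r * s = s * r" by (intro s(3)) simp
  have "(r * s) * (r * s) = r * (s * r) * s" by (simp add: mult.assoc)
  also have "\<dots> = a * b" by (simp add: rs[symmetric]) (simp add: r(1)[symmetric] s(1)[symmetric] mult.assoc)
  finally show ?thesis
    using cpos_of_square[of "r * s"] r(2) s(2) rs by (simp add: star_mult)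
qed

text \<open>If \<open>norm (a + b)\<close> is at most 1, then 1 - a = (1 - (a + b)) + b is positive.
  Commuting roots of a and 1 - a have squares with sum 1, so the root of a is a contraction.\<close>

lemma cpos_norm_mono:
  assumes "cpos a" "cpos b"
  shows "norm a \<le> norm (a + b)"
proof -
  have le1: "norm a \<le> 1" if ab: "cpos a" "cpos b" "norm (a + b) \<le> 1" for a b :: 'a
  proof -
    have "cpos (1 *\<^sub>R 1 - (a + b))"
      using cpos_norm_diff[of "a + b" 1] ab by (simp add: cpos_def star_add)
    then have "cpos ((1 *\<^sub>R 1 - (a + b)) + b)" using ab(2) by (rule cpos_add)
    then have "cpos (1 - a)" by (simp add: algebra_simps)
    then obtain r where r: "r * r = 1 - a" "star r = r" "\<And>c. c * (1 - a) = (1 - a) * c \<Longrightarrow> c * r = r * c"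
      using cpos_sqrt by metis
    obtain s where s: "s * s = a" "star s = s" "\<And>c. c * a = a * c \<Longrightarrow> c * s = s * c"
      using cpos_sqrt[OF ab(1)] by metis
    have "a * r = r * a" by (rule r(3)) (simp add: algebra_simps)
    then have "r * s = s * r" by (intro s(3)) simp
    then have "norm s \<le> 1"
      using r(1,2) s(1,2) by (intro norm_le_one_of_squares[of s r]) simp_all
    then show ?thesis
      using norm_square_selfadjoint[OF s(2)] s(1) by (simp add: power_le_one)
  qed
  show ?thesis
  proof (rule field_le_epsilon)
    fix e :: real assume "e > 0"
    \<comment> \<open>The slack allows normalization even when \<open>a + b\<close>
      vanishes.\<close>
    define k where "k = norm (a + b) + e"
    have k: "k > 0" using \<open>e > 0\<close> norm_ge_zero[of "a + b"] by (simp add: k_def add_nonneg_pos)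
    have "norm ((1/k) *\<^sub>R a) \<le> 1"
      by (rule le1[of _ "(1/k) *\<^sub>R b"])
        (use assms k \<open>e > 0\<close> in \<open>simp_all add: cpos_scaleR scaleR_add_right[symmetric] del: scaleR_add_right\<close>, simp add: k_def)
    then show "norm a \<le> norm (a + b) + e" using k by (simp add: k_def field_simps)
  qed
qed

lemma cpos_antisym: assumes "cpos a" "cpos (- a)" shows "a = 0"
  using cpos_norm_mono[OF assms] by simp

text \<open>A convergent sequence is bounded, so one K serves all its members, and the inequality
  with K fixed is closed.\<close>

lemma cpos_LIMSEQ:
  assumes "\<And>n. cpos (X n)" "X \<longlonglongrightarrow> a"
  shows "cpos a"
proof -
  have "Bseq X" using assms(2) convergentI convergent_imp_Bseq by blast
  then obtain K where K: "K > 0" "\<And>n. norm (X n) \<le> K"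
    by (auto simp: Bseq_def)
  have "(\<lambda>n. norm (K *\<^sub>R 1 - X n)) \<longlonglongrightarrow> norm (K *\<^sub>R 1 - a)"
    by (intro tendsto_intros assms(2))
  then have "norm (K *\<^sub>R 1 - a) \<le> K"
    by (rule Lim_bounded[of _ _ 0]) (use cpos_norm_le[OF assms(1) K(2)] in blast)
  moreover have "(\<lambda>n. star (X n)) \<longlonglongrightarrow> star a"
    by (rule bounded_linear.tendsto[OF bounded_linear_star assms(2)])
  then have "star a = a"
    using assms LIMSEQ_unique by (auto simp: cpos_star)
  ultimately show ?thesis by (intro cposI)
qed

section \<open>Positivity of \<open>star c * c\<close>\<close>

text \<open>The powers of \<open>f\<close> grow like \<open>n * K ^ n\<close>, and for a self-adjoint element this bounds the
  norm by \<open>K\<close>.\<close>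

lemma norm_le_of_intertwining:
  fixes f e p q :: "'b::{cstar_algebra, real_normed_algebra_1}"
  assumes f: "star f = f" and fK: "f = K *\<^sub>R 1 + p * q" and int: "f * p = p * e"
    and e: "norm e \<le> K" and K: "K > 0"
  shows "norm f \<le> K"
proof (rule ccontr)
  assume "\<not> norm f \<le> K"
  define C where "C = norm p * norm q / K"
  have "C \<ge> 0" using K by (simp add: C_def)
  have pow_e: "norm (e ^ j) \<le> K ^ j" for j
    using order_trans[OF norm_power_ineq power_mono[OF e norm_ge_zero]] .
  have pw: "f ^ n * p = p * e ^ n" for n
  proof (induction n)
    case (Suc n)
    have "f ^ Suc n * p = f ^ n * (f * p)" by (simp add: power_Suc2 mult.assoc del: power_Suc)
    also have "\<dots> = p * e ^ n * e" by (simp add: int mult.assoc[symmetric] Suc)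
    finally show ?case by (simp add: power_Suc2 mult.assoc del: power_Suc)
  qed simp
  \<comment> \<open>From f^(n+1) = f^n (K + p q) = K f^n + p e^n q, each step adds one
    \<open>C\<close> after division by K^(n+1).\<close>
  have growth: "norm (f ^ n) \<le> K ^ n * (1 + n * C)" for n
  proof (induction n)
    case (Suc n)
    have "f ^ Suc n = K *\<^sub>R f ^ n + p * e ^ n * q"
      by (simp only: power_Suc2 pw[symmetric]) (simp add: fK[symmetric] mult.assoc distrib_left[symmetric]
        flip: fK, simp only: fK distrib_left mult_scaleR_right mult_1_right mult.assoc)
    also have "norm \<dots> \<le> K * norm (f ^ n) + norm (p * e ^ n * q)"
      using norm_triangle_ineq[of "K *\<^sub>R f ^ n" "p * e ^ n * q"] K by simp
    also have "norm (p * e ^ n * q) \<le> norm p * K ^ n * norm q"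
      by (intro order_trans[OF norm_mult_ineq] mult_mono order_refl pow_e)
        (use K in \<open>simp_all\<close>)
    also have "norm p * K ^ n * norm q = K ^ Suc n * C"
      using K by (simp add: C_def)
    finally show ?case
      using mult_left_mono[OF Suc, of K] K by (simp add: algebra_simps)
  qed simp
  \<comment> \<open>The C*-identity computes norms of squares only, so the growth is tested along
    exponents 2^k.\<close>
  have dyadic: "norm (f ^ (2 ^ k)) = norm f ^ (2 ^ k)" for k
  proof (induction k)
    case (Suc k)
    have "star (f ^ n) = f ^ n" for n
      by (induction n) (simp_all add: star_mult f power_commutes)
    then have "norm (f ^ (2 ^ k) * f ^ (2 ^ k)) = (norm (f ^ (2 ^ k)))\<^sup>2"
      by (rule norm_square_selfadjoint)
    then show ?case
      by (simp add: Suc power_mult power2_eq_square mult.commute[of 2] power_add[symmetric] mult_2_right)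
  qed simp
  define x where "x = norm f / K"
  have x: "x > 1" using \<open>\<not> norm f \<le> K\<close> K by (simp add: x_def)
  have bound: "x ^ (2 ^ k) \<le> 1 + 2 ^ k * C" for k
  proof -
    have "x ^ (2 ^ k) = norm (f ^ (2 ^ k)) / K ^ (2 ^ k)"
      by (simp add: x_def power_divide dyadic)
    also have "\<dots> \<le> 1 + 2 ^ k * C"
      using growth[of "2 ^ k"] K by (simp add: field_simps)
    finally show ?thesis .
  qed
  \<comment> \<open>The bound is linear in the exponent 2^k, whereas x^(2^k) with x > 1 is
    exponential in it.\<close>
  have "(\<lambda>n. of_nat n * (1 / x) ^ n) \<longlonglongrightarrow> 0"
    using x by (intro powser_times_n_limit_0) simp
  moreover have "filterlim (\<lambda>k. (2::nat) ^ k) sequentially sequentially"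
    by (rule filterlim_subseq) (simp add: strict_mono_def)
  ultimately have "(\<lambda>k. of_nat (2 ^ k) * (1 / x) ^ (2 ^ k)) \<longlonglongrightarrow> 0"
    by (rule filterlim_compose)
  then have "eventually (\<lambda>k. of_nat (2 ^ k) * (1 / x) ^ (2 ^ k) < 1 / (1 + C)) sequentially"
    by (rule order_tendstoD) (use \<open>C \<ge> 0\<close> in simp)
  then obtain k where "real (2 ^ k) * (1 / x) ^ (2 ^ k) < 1 / (1 + C)"
    by (auto simp: eventually_sequentially)
  then have "(1 + C) * 2 ^ k < x ^ (2 ^ k)"
    using x \<open>C \<ge> 0\<close> by (simp add: field_simps)
  moreover have "(1 + C) * 2 ^ k \<ge> 1 + 2 ^ k * C" by (simp add: algebra_simps)
  ultimately show False using bound[of k] by simp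
qed


text \<open>With p the root of h^2, the element w = p - h satisfies w^2 = 2 w p. Hence w intertwines
  K - w with K - 2 p, whose norm is at most K because 2 p is positive and K exceeds its
  norm.\<close>

lemma cpos_abs_minus:
  fixes h :: "'b::{cstar_algebra, real_normed_algebra_1}"
  assumes h: "star h = h"
  obtains p where "cpos p" "p * p = h * h" "p * h = h * p" "cpos (p - h)"
proof -
  obtain p where p: "p * p = h * h" "star p = p" "cpos p"
    "\<And>b. b * (h * h) = (h * h) * b \<Longrightarrow> b * p = p * b"
    using cpos_sqrt[OF cpos_of_square[OF h]] by metis
  have hp: "h * p = p * h" by (rule p(4)) (simp add: mult.assoc)
  define w where "w = p - h"
  define K where "K = norm (2 *\<^sub>R p) + 1"
  have w: "star w = w" by (simp add: w_def star_diff p(2) h)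
  have ww: "w * w = 2 *\<^sub>R (w * p)"
    by (simp add: w_def algebra_simps p(1) hp scaleR_2)
  have "norm (K *\<^sub>R 1 - w) \<le> K"
  proof (rule norm_le_of_intertwining[where p = w and q = "- 1" and e = "K *\<^sub>R 1 - 2 *\<^sub>R p"])
    show "(K *\<^sub>R 1 - w) * w = w * (K *\<^sub>R 1 - 2 *\<^sub>R p)"
      by (simp add: left_diff_distrib right_diff_distrib ww)
    have "cpos (2 *\<^sub>R p)" using p(3) by (rule cpos_scaleR) simp
    then show "norm (K *\<^sub>R 1 - 2 *\<^sub>R p) \<le> K"
      by (rule cpos_norm_le) (simp add: K_def)
    show "0 < K" by (simp add: K_def add_nonneg_pos)
  qed (simp_all add: star_diff star_scaleR w)
  with w have "cpos w" by (rule cposI)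
  then show thesis using p(1,3) hp that[of p] by (simp add: w_def)
qed

text \<open>This replaces the coincidence of the nonzero spectra of \<open>star t * t\<close> and
  \<open>t * star t\<close>: t intertwines K + \<open>t * star t\<close> with K +
  \<open>star t * t\<close>, and the latter has norm at most K by hypothesis.\<close>

lemma cpos_minus_swap:
  fixes t :: "'b::{cstar_algebra, real_normed_algebra_1}"
  assumes "cpos (- (star t * t))"
  shows "cpos (- (t * star t))"
proof -
  define K where "K = (norm t)\<^sup>2 + 1"
  have K: "K > 0" by (simp add: K_def add_nonneg_pos)
  have "norm (K *\<^sub>R 1 + t * star t) \<le> K"
  proof (rule norm_le_of_intertwining[where p = t and q = "star t" and e = "K *\<^sub>R 1 + star t * t"])
    show "norm (K *\<^sub>R 1 + star t * t) \<le> K"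
      using cpos_norm_le[OF assms, of K] by (simp add: norm_star_mult_self K_def)
  qed (use K in \<open>simp_all add: star_add star_scaleR star_mult distrib_left distrib_right mult.assoc\<close>)
  then show ?thesis
    by (intro cposI[of _ K]) (simp_all add: star_minus star_mult)
qed

lemma scaleC_ii_ii: "\<i> *\<^sub>C \<i> *\<^sub>C (x::'b::complex_vector) = - x"
  by (simp add: scaleC_scaleC scaleC_minus_left)

text \<open>x and -y are twice the real and imaginary parts of t, and the mixed terms cancel in x^2
  + y^2.\<close>

lemma cpos_star_mult_self_plus_swap:
  fixes t :: "'b::{cstar_algebra, real_normed_algebra_1}"
  shows "cpos (star t * t + t * star t)"
proof -
  define x where "x = t + star t"
  define y where "y = \<i> *\<^sub>C (t - star t)"
  have xy: "star x = x" "star y = y"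
    by (simp_all add: x_def y_def star_add star_diff star_scaleC scaleC_minus_left scaleC_diff_right)
  have "y * y = - ((t - star t) * (t - star t))"
    by (simp add: y_def mult_scaleC_left mult_scaleC_right scaleC_ii_ii)
  then have "x * x + y * y = 2 *\<^sub>R (star t * t + t * star t)"
    by (simp add: x_def algebra_simps scaleR_2)
  then have "star t * t + t * star t = (1/2) *\<^sub>R (x * x + y * y)" by simp
  then show ?thesis
    using cpos_scaleR[OF cpos_add[OF cpos_of_square[OF xy(1)] cpos_of_square[OF xy(2)]], of "1/2"]
    by simp
qed

text \<open>Kaplansky: if \<open>q = \<bar>h\<bar> - h\<close> is twice the negative part of \<open>h = star c * c\<close> and
  \<open>t = c * q\<close>, then \<open>star t * t = q * h * q\<close> is negative, hence so is \<open>t * star t\<close>, while the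
  sum of both is positive. So \<open>t = 0\<close>.\<close>

lemma cpos_star_mult_self:
  fixes c :: "'b::{cstar_algebra, real_normed_algebra_1}"
  shows "cpos (star c * c)"
proof -
  define h where "h = star c * c"
  have h: "star h = h" by (simp add: h_def star_mult)
  obtain p where p: "cpos p" "p * p = h * h" "p * h = h * p" "cpos (p - h)"
    using cpos_abs_minus[OF h] by metis
  define q where "q = p - h"
  have q: "star q = q" "cpos q" using p(4) by (simp_all add: q_def cpos_star)
  have qh: "q * h = h * q" by (simp add: q_def algebra_simps p(3))
  \<comment> \<open>From p^2 = h^2 and commutation, q^2 = -2 h q. So -h q^2 is twice a product of
    the commuting positive elements h^2 and q.\<close>
  have hhq: "- (h * q * q) = 2 *\<^sub>R ((h * h) * q)"
    by (simp add: q_def algebra_simps p(2,3) scaleR_2)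
  define t where "t = c * q"
  have tt: "star t * t = h * q * q"
    by (simp add: t_def star_mult q(1) h_def mult.assoc[symmetric])
      (simp add: mult.assoc h_def[symmetric], simp add: mult.assoc[symmetric] qh)
  have "cpos ((h * h) * q)"
    by (rule cpos_mult_commuting[OF cpos_of_square[OF h] q(2)]) (metis mult.assoc qh)
  then have neg: "cpos (- (star t * t))"
    unfolding tt hhq by (intro cpos_scaleR) auto
  have "cpos ((star t * t + t * star t) + - (t * star t))"
    by (intro cpos_add cpos_star_mult_self_plus_swap cpos_minus_swap neg)
  then have "star t * t = 0"
    using neg by (intro cpos_antisym) simp_all
  then have hqq: "h * q * q = 0" by (simp add: tt)
  with hhq have hhq0: "(h * h) * q = 0" by simp
  \<comment> \<open>The same identity turns h q^2 = 0 into q^4 = 0, and the C*-identity applied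
    twice gives q = 0.\<close>
  have "q * q = - (2 *\<^sub>R (h * q))"
    by (simp add: q_def algebra_simps p(2,3) scaleR_2)
  then have "(q * q) * (q * q) = (- (2 *\<^sub>R (h * q))) * (q * q)" by simp
  also have "\<dots> = - (2 *\<^sub>R ((h * q * q) * q))" by (simp add: mult.assoc)
  finally have "(q * q) * (q * q) = 0" by (simp add: hqq)
  then have "norm (q * q) = 0"
    using norm_square_selfadjoint[of "q * q"] q(1) by (simp add: star_mult)
  then have "q = 0" using norm_square_selfadjoint[OF q(1)] by simp
  then have "p = h" by (simp add: q_def)
  then show ?thesis using p(1) by (simp add: h_def)
qed

lemma cpos_iff: "cpos a \<longleftrightarrow> (\<exists>c. a = star c * c)"
  by (metis cpos_sqrt cpos_star_mult_self)

lemma cpos_conj: "cpos a \<Longrightarrow> cpos (star b * a * b)"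
  unfolding cpos_iff by (metis mult.assoc star_mult)

text \<open>With K the norm of p, p + e = (K + e)(1 - g) where g has norm at most K/(K + e) < 1. The
  Neumann series gives an inverse v of p + e, and the inverse of its root s is s v.\<close>

lemma cpos_inverse_sqrt:
  fixes p :: "'b::{cstar_algebra, real_normed_algebra_1}"
  assumes "cpos p" "e > 0"
  obtains s a where "star s = s" "star a = a" "s * a = 1" "a * s = 1" "s * s = p + e *\<^sub>R 1"
proof -
  define K where "K = norm p"
  define g where "g = (1 / (K + e)) *\<^sub>R (K *\<^sub>R 1 - p)"
  have Ke: "K \<ge> 0" "K + e > 0" using assms(2) by (simp_all add: K_def add_nonneg_pos)
  have "norm (K *\<^sub>R 1 - p) < K + e"
    using cpos_norm_le[OF assms(1), of K] assms(2) by (simp add: K_def)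
  moreover have "norm g = norm (K *\<^sub>R 1 - p) / (K + e)"
    using Ke by (simp only: g_def norm_scaleR) simp
  ultimately have g: "norm g < 1" using Ke by (simp only: divide_less_eq_1_pos)
  have pe: "p + e *\<^sub>R 1 = (K + e) *\<^sub>R (1 - g)"
    using Ke by (simp add: g_def scaleR_diff_right) (simp add: scaleR_add_left)
  define z where "z = (\<Sum>n. g ^ n)"
  have sm: "summable (\<lambda>n. g ^ n)" by (rule complete_algebra_summable_geometric[OF g])
  have "z = (\<Sum>n. g ^ Suc n) + 1"
    using suminf_split_initial_segment[OF sm, of 1] by (simp add: z_def)
  moreover have "(\<Sum>n. g ^ Suc n) = g * z" "(\<Sum>n. g ^ Suc n) = z * g"
    using suminf_mult[OF sm, of g] suminf_mult2[OF sm, of g]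
    by (simp_all add: z_def power_commutes)
  ultimately have z: "(1 - g) * z = 1" "z * (1 - g) = 1"
    by (simp_all add: left_diff_distrib right_diff_distrib)
  define v where "v = (1 / (K + e)) *\<^sub>R z"
  have v: "(p + e *\<^sub>R 1) * v = 1" "v * (p + e *\<^sub>R 1) = 1"
    using Ke z by (simp_all add: pe v_def)
  have "cpos (p + e *\<^sub>R 1)"
    using assms cpos_star_mult_self[of 1] by (intro cpos_add cpos_scaleR) simp_all
  then obtain s where s: "s * s = p + e *\<^sub>R 1" "star s = s"
    using cpos_sqrt by metis
  \<comment> \<open>Insert v s^2 = 1 on the left and then cancel s^2 v = 1 on the right.\<close>
  have sv: "s * v = v * s"
  proof -
    have "s * v = v * (s * s) * (s * v)" using v(2) s(1) by simp
    also have "\<dots> = v * s * (s * s * v)" by (simp only: mult.assoc)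
    also have "\<dots> = v * s" using v(1) s(1) by simp
    finally show ?thesis .
  qed
  have sa: "s * (s * v) = 1" using v(1) s(1) by (simp add: mult.assoc[symmetric])
  have as: "(s * v) * s = 1" using v(2) s(1) unfolding sv by (simp add: mult.assoc)
  have "star (s * v) * s = 1" using arg_cong[OF sa, of star] by (simp add: star_mult s(2))
  then have "star (s * v) * (s * (s * v)) = s * v" by (simp add: mult.assoc[symmetric])
  then have "star (s * v) = s * v" by (simp add: sa)
  with sa as s that[of s "s * v"] show thesis by blast
qed

text \<open>Take a to be the inverse root of p + e. Then a p a lies below 1, so the norm hypothesis
  gives that a q a lies below M; conjugating back by the root yields q below M (p + e), and e tends
  to 0.\<close>

lemma cpos_diff_of_norm_le:
  fixes p q :: "'b::{cstar_algebra, real_normed_algebra_1}"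
  assumes p: "cpos p" and q: "cpos q" and M: "0 \<le> M"
    and le: "\<And>a. norm (star a * q * a) \<le> M * norm (star a * p * a)"
  shows "cpos (M *\<^sub>R p - q)"
proof -
  have pos: "cpos (M *\<^sub>R (p + e *\<^sub>R 1) - q)" if e: "e > 0" for e
  proof -
    obtain s a where sa: "star s = s" "star a = a" "s * a = 1" "a * s = 1" "s * s = p + e *\<^sub>R 1"
      using cpos_inverse_sqrt[OF p e] by metis
    have "a * p * a + e *\<^sub>R (a * a) = a * (s * s) * a"
      by (simp add: sa(5) algebra_simps)
    also have "\<dots> = (a * s) * (s * a)" by (simp only: mult.assoc)
    finally have "a * p * a + e *\<^sub>R (a * a) = 1" by (simp add: sa)
    moreover have "norm (a * p * a) \<le> norm (a * p * a + e *\<^sub>R (a * a))"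
      using cpos_conj[OF p, of a] e by (intro cpos_norm_mono cpos_scaleR cpos_of_square) (simp_all add: sa)
    ultimately have "M * norm (a * p * a) \<le> M * 1" using M by (intro mult_left_mono) simp_all
    then have "norm (a * q * a) \<le> M" using le[of a] by (simp add: sa)
    moreover have "star (a * q * a) = a * q * a"
      by (simp add: star_mult sa cpos_star[OF q] mult.assoc)
    ultimately have "cpos (M *\<^sub>R 1 - a * q * a)" by (intro cpos_norm_diff)
    then have "cpos (star s * (M *\<^sub>R 1 - a * q * a) * s)" by (rule cpos_conj)
    also have "star s * (M *\<^sub>R 1 - a * q * a) * s = M *\<^sub>R (s * s) - (s * a) * q * (a * s)"
      by (simp add: sa(1) right_diff_distrib left_diff_distrib mult.assoc)
    finally show ?thesis by (simp add: sa)
  qed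
  show ?thesis
  proof (rule cpos_LIMSEQ)
    show "cpos (M *\<^sub>R (p + (1 / real (Suc n)) *\<^sub>R 1) - q)" for n by (rule pos) simp
    have "(\<lambda>n. M *\<^sub>R (p + (1 / real (Suc n)) *\<^sub>R 1) - q) \<longlonglongrightarrow> M *\<^sub>R (p + 0 *\<^sub>R 1) - q"
      using LIMSEQ_inverse_real_of_nat by (intro tendsto_intros) (simp add: inverse_eq_divide)
    then show "(\<lambda>n. M *\<^sub>R (p + (1 / real (Suc n)) *\<^sub>R 1) - q) \<longlonglongrightarrow> M *\<^sub>R p - q" by simp
  qed
qed


subsection \<open>Order and norm in a C*-algebra\<close>

definition unitization_embed :: "'a::cstar_algebra \<Rightarrow> 'a unitization"
  where "unitization_embed a = Unitize a 0"

lemma unitization_embed_simps: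
  "unitization_embed (a + b) = unitization_embed a + unitization_embed b"
  "unitization_embed (a - b) = unitization_embed a - unitization_embed b"
  "unitization_embed (a * b) = unitization_embed a * unitization_embed b"
  "unitization_embed (star a) = star (unitization_embed a)"
  "unitization_embed (r *\<^sub>R a) = r *\<^sub>R unitization_embed a"
  "unitization_embed 0 = 0"
  by (simp_all add: unitization_embed_def unitization_simps star_unitization_def)

lemma norm_unitization_embed [simp]: "norm (unitization_embed a) = norm a"
proof (rule antisym)
  show "norm (unitization_embed a) \<le> norm a"
    by (rule norm_unitization_le)
      (simp_all add: unitization_embed_def unitization_act_def norm_mult_ineq)
  have "norm a * norm a = norm (unitization_act (unitization_embed a) (star a))"
    using norm_star_mult_self[of "star a"]
    by (simp add: unitization_embed_def unitization_act_def power2_eq_square)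
  also have "\<dots> \<le> norm (unitization_embed a) * norm a"
    using norm_unitization_act_le[of "unitization_embed a" "star a"] by simp
  finally show "norm a \<le> norm (unitization_embed a)"
    by (cases "a = 0") simp_all
qed

lemma bounded_linear_unitization_embed: "bounded_linear unitization_embed"
  by (rule bounded_linear_intro[where K = 1]) (simp_all add: unitization_embed_simps)

lemma cstar_le_iff_diff: "a \<le>\<^sub>C b \<longleftrightarrow> 0 \<le>\<^sub>C b - a"
  by (simp add: cstar_le_def)

lemma star_mult_self_nonneg [simp]: "0 \<le>\<^sub>C star a * a"
  by (auto simp: cstar_le_def)

text \<open>For the converse, a root taken in the unitization has a scalar part whose square is 0,
  so it already lies in the algebra.\<close>

lemma nonneg_iff_cpos: "0 \<le>\<^sub>C a \<longleftrightarrow> cpos (unitization_embed a)"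
proof
  assume "0 \<le>\<^sub>C a"
  then show "cpos (unitization_embed a)"
    by (auto simp: cstar_le_def unitization_embed_simps cpos_star_mult_self)
next
  assume "cpos (unitization_embed a)"
  then obtain r where r: "r * r = unitization_embed a" "star r = r"
    using cpos_sqrt by metis
  have "scalar_part r = 0"
    using arg_cong[OF r(1), of scalar_part] by (simp add: times_unitization_def unitization_embed_def)
  then have "r = unitization_embed (alg_part r)"
    by (simp add: unitization_embed_def unitization.expand)
  then have "unitization_embed a = unitization_embed (star (alg_part r) * alg_part r)"
    using r by (metis unitization_embed_simps(3,4))
  then show "0 \<le>\<^sub>C a"
    by (auto simp: cstar_le_def unitization_embed_def)
qed

lemma nonneg_add: "0 \<le>\<^sub>C a \<Longrightarrow> 0 \<le>\<^sub>C b \<Longrightarrow> 0 \<le>\<^sub>C a + b"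
  by (simp add: nonneg_iff_cpos unitization_embed_simps cpos_add)

lemma nonneg_scaleR: "0 \<le>\<^sub>C a \<Longrightarrow> 0 \<le> r \<Longrightarrow> 0 \<le>\<^sub>C r *\<^sub>R a"
  by (simp add: nonneg_iff_cpos unitization_embed_simps cpos_scaleR)

lemma nonneg_zero [simp]: "0 \<le>\<^sub>C 0"
  by (simp add: nonneg_iff_cpos unitization_embed_simps)

lemma nonneg_sum: "(\<And>i. i \<in> I \<Longrightarrow> 0 \<le>\<^sub>C f i) \<Longrightarrow> 0 \<le>\<^sub>C sum f I"
  by (induction I rule: infinite_finite_induct) (simp_all add: nonneg_add)

lemma cstar_le_trans: "a \<le>\<^sub>C b \<Longrightarrow> b \<le>\<^sub>C c \<Longrightarrow> a \<le>\<^sub>C c"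
  using nonneg_add[of "b - a" "c - b"] 
  by (simp add: cstar_le_iff_diff[of a] cstar_le_iff_diff[of b])

lemma norm_mono: assumes "0 \<le>\<^sub>C a" "a \<le>\<^sub>C b" shows "norm a \<le> norm b"
  using cpos_norm_mono[of "unitization_embed a" "unitization_embed (b - a)"] assms
  by (simp add: cstar_le_iff_diff[of a b] nonneg_iff_cpos unitization_embed_simps)

lemma nonneg_LIMSEQ:
  assumes "\<And>n. 0 \<le>\<^sub>C X n" "X \<longlonglongrightarrow> a"
  shows "0 \<le>\<^sub>C a"
  using assms(1) bounded_linear.tendsto[OF bounded_linear_unitization_embed assms(2)]
  unfolding nonneg_iff_cpos by (rule cpos_LIMSEQ)

lemma nonneg_suminf: "summable f \<Longrightarrow> (\<And>n. 0 \<le>\<^sub>C f n) \<Longrightarrow> 0 \<le>\<^sub>C suminf f"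
  by (rule nonneg_LIMSEQ[OF _ summable_LIMSEQ]) (simp_all add: nonneg_sum)

lemma sum_le_suminf_cstar:
  assumes "summable f" "\<And>n. 0 \<le>\<^sub>C f n" "finite I"
  shows "sum f I \<le>\<^sub>C suminf f"
proof -
  let ?g = "\<lambda>n. if n \<in> I then f n else 0"
  have g: "?g sums sum f I" using assms(3) by (rule sums_If_finite_set)
  have "0 \<le>\<^sub>C (\<Sum>n. f n - ?g n)"
    using assms g by (intro nonneg_suminf summable_diff) (auto simp: sums_iff)
  also have "(\<Sum>n. f n - ?g n) = suminf f - sum f I"
    using suminf_diff[OF assms(1) sums_summable[OF g]] sums_unique[OF g] by simp
  finally show ?thesis by (simp add: cstar_le_iff_diff[of "sum f I"])
qed

text \<open>The comparison is made on blocks of the series, not on the norms of terms, because norm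
  convergence of positive terms need not be absolute.\<close>

lemma summable_cstar_le:
  assumes g: "summable g" and f: "\<And>n. 0 \<le>\<^sub>C f n" and le: "\<And>n. f n \<le>\<^sub>C g n"
  shows "summable f"
  unfolding summable_Cauchy
proof (intro allI impI)
  fix e :: real assume "e > 0"
  then obtain N where N: "\<And>m n. m \<ge> N \<Longrightarrow> norm (sum g {m..<n}) < e"
    using g unfolding summable_Cauchy by blast
  have "norm (sum f {m..<n}) \<le> norm (sum g {m..<n})" for m n
    using f le
    by (intro norm_mono nonneg_sum)
      (simp_all add: cstar_le_iff_diff[of "sum f _"] cstar_le_iff_diff[of "f _"] sum_subtractf[symmetric] nonneg_sum)
  then show "\<exists>N. \<forall>m\<ge>N. \<forall>n. norm (sum f {m..<n}) < e"
    using N by (meson le_less_trans)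
qed

text \<open>Think of p, q, r as the products <x,x>, <x,y>, <y,y>, so that \<open>form\<close> is the
  positivity of the product of x a - y with itself. Choosing a = q/k with k at least
  \<open>norm p\<close> leaves r above (1/k) \<open>star q * q\<close>. The abstract form serves
  finite sums and modules alike.\<close>

lemma norm_Cauchy_Schwarz_cstar:
  fixes p q r :: "'a::cstar_algebra"
  assumes p: "0 \<le>\<^sub>C p" and form: "\<And>a. 0 \<le>\<^sub>C star a * p * a - star a * q - star q * a + r"
  shows "(norm q)\<^sup>2 \<le> norm p * norm r"
proof (rule field_le_epsilon)
  fix e :: real assume e: "e > 0"
  \<comment> \<open>The slack keeps k positive when p = 0; its denominator limits the final error to
    e.\<close>
  define k where "k = norm p + e / (norm r + 1)"
  have d: "e / (norm r + 1) > 0" using e by (simp add: add_nonneg_pos)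
  have k: "k > 0" "norm p \<le> k"
    using d norm_ge_zero[of p] unfolding k_def by linarith+
  have "0 \<le>\<^sub>C (1/k\<^sup>2) *\<^sub>R (star q * p * q) - (2/k) *\<^sub>R (star q * q) + r"
    using form[of "(1/k) *\<^sub>R q"] k(1)
    by (simp add: star_scaleR power2_eq_square diff_diff_eq scaleR_left_distrib[symmetric])
  moreover have "0 \<le>\<^sub>C k *\<^sub>R (star q * q) - star q * p * q"
  proof -
    let ?e = unitization_embed
    have "cpos (k *\<^sub>R 1 - ?e p)"
      using p k(2) by (intro cpos_norm_diff) (simp_all add: nonneg_iff_cpos cpos_star)
    then have "cpos (star (?e q) * (k *\<^sub>R 1 - ?e p) * ?e q)" by (rule cpos_conj)
    also have "star (?e q) * (k *\<^sub>R 1 - ?e p) * ?e q = ?e (k *\<^sub>R (star q * q) - star q * p * q)"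
      by (simp add: unitization_embed_simps algebra_simps)
    finally show ?thesis by (simp add: nonneg_iff_cpos)
  qed
  then have "0 \<le>\<^sub>C (1/k\<^sup>2) *\<^sub>R (k *\<^sub>R (star q * q) - star q * p * q)"
    by (rule nonneg_scaleR) simp
  ultimately have "0 \<le>\<^sub>C ((1/k\<^sup>2) *\<^sub>R (star q * p * q) - (2/k) *\<^sub>R (star q * q) + r)
      + (1/k\<^sup>2) *\<^sub>R (k *\<^sub>R (star q * q) - star q * p * q)"
    by (rule nonneg_add)
  also have "\<dots> = r - (1/k) *\<^sub>R (star q * q)"
  proof -
    have "(2/k) *\<^sub>R z = (1/k) *\<^sub>R z + (1/k\<^sup>2) *\<^sub>R k *\<^sub>R z" for z :: 'a
      using k(1) by (simp add: scaleR_left_distrib[symmetric] power2_eq_square)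
    then show ?thesis by (simp add: scaleR_diff_right)
  qed
  finally have "norm ((1/k) *\<^sub>R (star q * q)) \<le> norm r"
    using k(1) by (intro norm_mono nonneg_scaleR) (simp_all add: cstar_le_iff_diff[of _ r])
  then have "(norm q)\<^sup>2 \<le> k * norm r"
    using k(1) by (simp add: norm_star_mult_self field_simps)
  also have "\<dots> = norm p * norm r + e * (norm r / (norm r + 1))"
    by (simp add: k_def distrib_right)
  also have "e * (norm r / (norm r + 1)) \<le> e * 1"
    using e by (intro mult_left_mono) (simp_all add: divide_le_eq_1 add_nonneg_pos)
  finally show "(norm q)\<^sup>2 \<le> norm p * norm r + e" by simp
qed

lemma norm_sum_star_mult_le:
  fixes a b :: "'i \<Rightarrow> 'a::cstar_algebra"
  shows "(norm (\<Sum>i\<in>I. star (a i) * b i))\<^sup>2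
    \<le> norm (\<Sum>i\<in>I. star (a i) * a i) * norm (\<Sum>i\<in>I. star (b i) * b i)"
proof (rule norm_Cauchy_Schwarz_cstar)
  fix c
  let ?q = "\<Sum>i\<in>I. star (a i) * b i"
  have "star ?q = (\<Sum>i\<in>I. star (b i) * a i)"
    using linear_sum[OF bounded_linear.linear[OF bounded_linear_star], of "\<lambda>i. star (a i) * b i" I]
    by (simp add: star_mult)
  then have "star c * (\<Sum>i\<in>I. star (a i) * a i) * c - star c * ?q - star ?q * c
      + (\<Sum>i\<in>I. star (b i) * b i) = (\<Sum>i\<in>I. star (a i * c - b i) * (a i * c - b i))"
    by (simp add: sum_distrib_left sum_distrib_right sum_subtractf[symmetric] sum.distrib[symmetric]
      star_diff star_mult algebra_simps)
  then show "0 \<le>\<^sub>C star c * (\<Sum>i\<in>I. star (a i) * a i) * c - star c * ?q - star ?q * c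
      + (\<Sum>i\<in>I. star (b i) * b i)"
    by (simp add: nonneg_sum)
qed (simp add: nonneg_sum)

text \<open>The difference of the two sides is \<open>star c * c\<close> with
  \<open>c = sqrt t * b - (a - b) / sqrt t\<close>.\<close>

lemma star_mult_self_le_weighted:
  fixes a b :: "'a::cstar_algebra"
  assumes "t > 0"
  shows "star a * a \<le>\<^sub>C (1 + t) *\<^sub>R (star b * b) + (1 + 1/t) *\<^sub>R (star (a - b) * (a - b))"
proof -
  define c where "c = sqrt t *\<^sub>R b - (1 / sqrt t) *\<^sub>R (a - b)"
  define d where "d = a - b"
  have a: "a = b + d" by (simp add: d_def)
  have "star c * c = t *\<^sub>R (star b * b) - star b * d - star d * b + (1/t) *\<^sub>R (star d * d)"
    using assms by (simp add: c_def d_def[symmetric] star_diff star_scaleR left_diff_distrib right_diff_distrib)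
      (simp add: scaleR_diff_right)
  then have "(1 + t) *\<^sub>R (star b * b) + (1 + 1/t) *\<^sub>R (star d * d) - star a * a = star c * c"
    by (simp add: a star_add algebra_simps)
  then show ?thesis by (simp add: cstar_le_iff_diff[of "star a * a"] d_def)
qed


subsection \<open>Uniform boundedness\<close>

text \<open>By Baire some \<open>E n\<close> contains a ball of radius r; moving its centre to 0
  costs the 2 in 2n/r.\<close>

lemma uniform_boundedness:
  fixes F :: "'i \<Rightarrow> 'x::banach \<Rightarrow> 'b::real_normed_vector"
  assumes lin: "\<And>i. i \<in> I \<Longrightarrow> bounded_linear (F i)"
    and pointwise: "\<And>x. \<exists>C. \<forall>i\<in>I. norm (F i x) \<le> C"
  shows "\<exists>L\<ge>0. \<forall>i\<in>I. \<forall>x. norm (F i x) \<le> L * norm x"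
proof -
  define E where "E n = {x. \<forall>i\<in>I. norm (F i x) \<le> real n}" for n
  have "closed {x. norm (F i x) \<le> real n}" if "i \<in> I" for i n
    using bounded_linear.continuous_on[OF lin[OF that] continuous_on_id]
    by (intro closed_Collect_le continuous_intros) simp_all
  moreover have "E n = (\<Inter>i\<in>I. {x. norm (F i x) \<le> real n})" for n
    by (auto simp: E_def)
  ultimately have closed: "closed (E n)" for n by auto
  have "x \<in> \<Union>(range E)" for x
  proof -
    obtain C where "\<forall>i\<in>I. norm (F i x) \<le> C" using pointwise by blast
    moreover obtain n where "C \<le> real n" using real_arch_simple by blast
    ultimately have "x \<in> E n" by (auto simp: E_def intro: order_trans)
    then show ?thesis by blast
  qed
  then have cover: "\<Union>(range E) = UNIV" by blast
  have "\<exists>n. interior (E n) \<noteq> {}"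
  proof (rule ccontr)
    assume "\<not> ?thesis"
    then have "euclidean interior_of \<Union>(range E) = {}"
      by (intro Baire_category_alt)
        (auto simp: completely_metrizable_space_euclidean closed)
    then show False by (simp add: cover)
  qed
  then obtain n x0 where "x0 \<in> interior (E n)" by blast
  then obtain r where r: "r > 0" "cball x0 r \<subseteq> E n"
    by (meson interior_subset mem_interior_cball)
  have "norm (F i x) \<le> (2 * real n / r) * norm x" if i: "i \<in> I" for i x
  proof (cases "x = 0")
    case True
    then show ?thesis using linear_0[OF bounded_linear.linear[OF lin[OF i]]] by simp
  next
    case False
    let ?u = "(r / norm x) *\<^sub>R x"
    have "x0 + ?u \<in> E n" "x0 \<in> E n"
      using r(1) False by (auto simp: dist_norm intro!: subsetD[OF r(2)])
    then have 1: "norm (F i (x0 + ?u)) \<le> real n" "norm (F i x0) \<le> real n"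
      using i by (auto simp: E_def)
    have l: "linear (F i)" by (rule bounded_linear.linear[OF lin[OF i]])
    have "(r / norm x) *\<^sub>R F i x = F i (x0 + ?u) - F i x0"
      by (simp add: linear_add[OF l] linear_scale[OF l])
    then have "norm ((r / norm x) *\<^sub>R F i x) \<le> 2 * real n"
      using norm_triangle_ineq4[of "F i (x0 + ?u)" "F i x0"] 1 by simp
    then show ?thesis using r False by (simp add: field_simps)
  qed
  then show ?thesis using r by (intro exI[of _ "2 * real n / r"]) auto
qed


subsection \<open>Operators into the standard module\<close>

text \<open>The conjugate lies in the ideal, so taking \<open>alg_part\<close> loses nothing. As a
  bounded linear map on the algebra it can be moved through infinite sums.\<close>

definition unitization_conj :: "'a::cstar_algebra unitization \<Rightarrow> 'a \<Rightarrow> 'a"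
  where "unitization_conj u c = alg_part (star u * unitization_embed c * u)"

lemma unitization_embed_conj:
  "unitization_embed (unitization_conj u c) = star u * unitization_embed c * u"
  by (simp add: unitization_conj_def unitization_embed_def times_unitization_def)

lemma bounded_linear_unitization_conj: "bounded_linear (unitization_conj u)"
proof (rule bounded_linear_intro[where K = "norm u * norm u"])
  fix c d :: 'a and r :: real
  show "unitization_conj u (c + d) = unitization_conj u c + unitization_conj u d"
    "unitization_conj u (r *\<^sub>R c) = r *\<^sub>R unitization_conj u c"
    by (simp_all add: unitization_conj_def unitization_embed_simps distrib_left distrib_right
      plus_unitization_def[of "star u * _ * u"] scaleR_unitization_def[of r "star u * _ * u"])
  have "norm (star u * unitization_embed c * u) \<le> norm u * norm c * norm u"
    by (intro order_trans[OF norm_mult_ineq] mult_right_mono) (simp_all add: norm_mult_ineq[THEN order_trans])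
  then show "norm (unitization_conj u c) \<le> norm c * (norm u * norm u)"
    by (simp add: norm_unitization_embed[of "unitization_conj u c", symmetric] unitization_embed_conj
      mult_ac del: norm_unitization_embed)
qed

lemma unitization_conj_star_mult:
  "unitization_conj u (star c * c) = star (c * alg_part u + scalar_part u *\<^sub>C c) * (c * alg_part u + scalar_part u *\<^sub>C c)"
  by (simp add: unitization_conj_def unitization_embed_def times_unitization_def star_unitization_def
    star_add star_mult star_scaleC algebra_simps mult_scaleC_left mult_scaleC_right scaleC_add_right
    scaleC_scaleC)

definition unit_vec :: "nat \<Rightarrow> 'a::cstar_algebra \<Rightarrow> nat \<Rightarrow> 'a"
  where "unit_vec n a = (\<lambda>k. if k = n then a else 0)"

lemma ell2_finite_support: "finite I \<Longrightarrow> (\<And>n. n \<notin> I \<Longrightarrow> w n = 0) \<Longrightarrow> w \<in> ell2"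
  unfolding ell2_def by (auto intro!: summable_finite)

lemma ell2_ip_finite_support:
  "finite I \<Longrightarrow> (\<And>n. n \<notin> I \<Longrightarrow> w n = 0) \<Longrightarrow> ell2_ip v w = (\<Sum>n\<in>I. star (v n) * w n)"
  unfolding ell2_ip_def by (rule suminf_finite) simp_all

lemma unit_vec_in_ell2: "unit_vec n a \<in> ell2"
  by (rule ell2_finite_support[of "{n}"]) (simp_all add: unit_vec_def)

lemma ell2_ip_unit_vec: "ell2_ip v (unit_vec n a) = star (v n) * a"
  using ell2_ip_finite_support[of "{n}" "unit_vec n a" v] by (simp add: unit_vec_def)

lemma star_mult_left_cancel:
  fixes c d :: "'a::cstar_algebra"
  assumes "\<And>b. star b * c = star b * d"
  shows "c = d"
proof -
  have "star (c - d) * (c - d) = 0" using assms[of "c - d"] by (simp add: right_diff_distrib)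
  then show ?thesis by (simp add: star_mult_self_eq_0_iff)
qed

context hilbert_module
begin

lemma ip_add_left: "ip (x + y) z = ip x z + ip y z"
  by (metis ip_add_right star_add star_ip)

lemma ip_scaleC_left: "ip (c *\<^sub>C x) y = cnj c *\<^sub>C ip x y"
  by (metis ip_scaleC_right star_ip star_scaleC)

lemma ip_scaleR_right: "ip x (r *\<^sub>R y) = r *\<^sub>R ip x y"
  by (metis ip_scaleC_right scaleC_of_real)

lemma ip_minus_right: "ip x (- y) = - ip x y"
  using ip_scaleR_right[of x "- 1" y] by simp

lemma ip_diff_right: "ip x (y - z) = ip x y - ip x z"
  using ip_add_right[of x y "- z"] by (simp add: ip_minus_right)

lemma ip_diff_left: "ip (x - y) z = ip x z - ip y z"
  by (metis ip_diff_right star_diff star_ip)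

lemma ip_zero_right [simp]: "ip x 0 = 0"
  using ip_diff_right[of x 0 0] by simp

lemma norm_ip_self: "norm (ip x x) = (norm x)\<^sup>2"
  by (simp add: norm_eq_sqrt_ip)

lemma norm_ip_le: "norm (ip x y) \<le> norm x * norm y"
proof -
  have "(norm (ip x y))\<^sup>2 \<le> norm (ip x x) * norm (ip y y)"
  proof (rule norm_Cauchy_Schwarz_cstar[OF ip_nonneg])
    fix a
    have "star a * ip x x * a - star a * ip x y - star (ip x y) * a + ip y y
        = ip (act x a - y) (act x a - y)"
      by (simp add: ip_diff_left ip_diff_right ip_act_left ip_act_right star_ip algebra_simps)
    then show "0 \<le>\<^sub>C star a * ip x x * a - star a * ip x y - star (ip x y) * a + ip y y"
      by (simp add: ip_nonneg)
  qed
  then have "(norm (ip x y))\<^sup>2 \<le> (norm x * norm y)\<^sup>2"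
    by (simp add: norm_ip_self power_mult_distrib)
  then show ?thesis by (rule power2_le_imp_le) simp
qed

lemma bounded_linear_ip: "bounded_linear (ip x)"
  by (rule bounded_linear_intro[where K = "norm x"])
    (simp_all add: ip_add_right ip_scaleR_right norm_ip_le mult.commute[of _ "norm x"])

lemma mult_adj_ip:
  assumes "v \<in> multiplier_module ip"
  shows "ip (v a) z = star a * mult_adj ip v z"
  using is_adjoint_mult_adj[OF assms] by (simp add: is_adjoint_def cstar_ip_def)

text \<open>Linearity is not part of \<open>is_adjoint\<close>: it is read off from
  \<open>ip (v a) z\<close>, because the products \<open>star a * c\<close> for all a determine
  c.\<close>

lemma
  assumes v: "v \<in> multiplier_module ip"
  shows mult_pairing_add: "mult_pairing ip v (y + z) = mult_pairing ip v y + mult_pairing ip v z"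
    and mult_pairing_scaleC: "mult_pairing ip v (c *\<^sub>C z) = c *\<^sub>C mult_pairing ip v z"
    and mult_pairing_act: "mult_pairing ip v (act z a) = mult_pairing ip v z * a"
  unfolding mult_pairing_def
  by (rule star_mult_left_cancel;
    simp add: distrib_left mult_scaleC_right mult.assoc[symmetric] mult_adj_ip[OF v, symmetric]
      ip_add_right ip_scaleC_right ip_act_right)+

lemma mult_pairing_scaleR:
  "v \<in> multiplier_module ip \<Longrightarrow> mult_pairing ip v (r *\<^sub>R z) = r *\<^sub>R mult_pairing ip v z"
  by (metis mult_pairing_scaleC scaleC_of_real)

text \<open>An operator inequality from a norm inequality: perturb \<open>\<langle>z, z\<rangle>\<close> to an invertible element
  \<open>s\<^sup>2\<close> and test the norm inequality at \<open>z s\<^sup>-\<^sup>1\<close>. This needs the action of the unitization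
  on the module.\<close>

lemma analysis_operator_le:
  assumes w: "\<And>n. w n \<in> multiplier_module ip"
    and summ: "\<And>z. summable (\<lambda>n. star (mult_pairing ip (w n) z) * mult_pairing ip (w n) z)"
    and le: "\<And>z. norm (\<Sum>n. star (mult_pairing ip (w n) z) * mult_pairing ip (w n) z) \<le> M * (norm z)\<^sup>2"
    and M: "0 \<le> M"
  shows "(\<Sum>n. star (mult_pairing ip (w n) z) * mult_pairing ip (w n) z) \<le>\<^sub>C M *\<^sub>R ip z z"
proof -
  define G where "G z = (\<Sum>n. star (mult_pairing ip (w n) z) * mult_pairing ip (w n) z)" for z
  have G0: "0 \<le>\<^sub>C G z" unfolding G_def by (rule nonneg_suminf[OF summ]) simp
  have "cpos (M *\<^sub>R unitization_embed (ip z z) - unitization_embed (G z))"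
  proof (rule cpos_diff_of_norm_le)
    show "cpos (unitization_embed (ip z z))" "cpos (unitization_embed (G z))"
      using ip_nonneg G0 by (simp_all add: nonneg_iff_cpos)
    fix u :: "'a unitization"
    \<comment> \<open>This is z acted on by u, so passing from z to y conjugates both sides of the
      norm hypothesis by u.\<close>
    define y where "y = act z (alg_part u) + scalar_part u *\<^sub>C z"
    have "mult_pairing ip (w n) y
        = mult_pairing ip (w n) z * alg_part u + scalar_part u *\<^sub>C mult_pairing ip (w n) z" for n
      by (simp add: y_def mult_pairing_add mult_pairing_act mult_pairing_scaleC w)
    then have "star (mult_pairing ip (w n) y) * mult_pairing ip (w n) y
        = unitization_conj u (star (mult_pairing ip (w n) z) * mult_pairing ip (w n) z)" for n
      by (simp only: unitization_conj_star_mult)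
    then have "G y = unitization_conj u (G z)"
      unfolding G_def by (simp only: bounded_linear.suminf[OF bounded_linear_unitization_conj summ])
    moreover have "ip y y = unitization_conj u (ip z z)"
      by (simp add: y_def ip_add_left ip_add_right ip_scaleC_left ip_scaleC_right ip_act_left
        ip_act_right unitization_conj_def unitization_embed_def times_unitization_def
        star_unitization_def algebra_simps mult_scaleC_left mult_scaleC_right scaleC_add_right
        scaleC_scaleC)
    moreover have "norm (G y) \<le> M * norm (ip y y)"
      using le[of y] by (simp add: G_def norm_ip_self)
    ultimately show "norm (star u * unitization_embed (G z) * u)
        \<le> M * norm (star u * unitization_embed (ip z z) * u)"
      by (simp add: unitization_embed_conj[symmetric])
  qed (rule M)
  then show ?thesis
    by (simp add: cstar_le_iff_diff[of "suminf _"] nonneg_iff_cpos unitization_embed_simps G_def)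
qed

text \<open>Apply uniform boundedness on the module to the maps \<open>ip (S w)\<close>, where w
  runs through the finitely supported vectors of norm at most 1. They are pointwise bounded, since
  \<open>ip z (S w)\<close> is the product of \<open>V z\<close> with w, and truncations of
  \<open>V z\<close> recover its norm.\<close>

lemma adjointable_ell2_bounded:
  assumes V: "V \<in> adjointable_ell2 ip"
  shows "\<exists>L\<ge>0. \<forall>z. norm (ell2_ip (V z) (V z)) \<le> L * (norm z)\<^sup>2"
proof -
  obtain S where "is_adjoint UNIV ip ell2 ell2_ip V S"
    using V by (auto simp: adjointable_ell2_def adjointable_def)
  then have Vl: "V z \<in> ell2" and adj: "w \<in> ell2 \<Longrightarrow> ell2_ip (V z) w = ip z (S w)" for z w
    by (auto simp: is_adjoint_def)
  have summ: "summable (\<lambda>n. star (V z n) * V z n)" for z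
    using Vl by (simp add: ell2_def)
  define P where "P N z = (\<Sum>n<N. star (V z n) * V z n)" for N z
  define W where "W = {w :: nat \<Rightarrow> 'a. \<exists>N. (\<forall>n. n \<notin> {..<N} \<longrightarrow> w n = 0) \<and> norm (\<Sum>n<N. star (w n) * w n) \<le> 1}"
  have W_ell2: "w \<in> ell2" if "w \<in> W" for w
    using that unfolding W_def by (auto intro: ell2_finite_support[of "{..<_}"])
  have P_le: "norm (P N z) \<le> norm (ell2_ip (V z) (V z))" for N z
    unfolding P_def ell2_ip_def
    by (intro norm_mono nonneg_sum sum_le_suminf_cstar summ) simp_all
  have "\<exists>L\<ge>0. \<forall>w\<in>W. \<forall>z. norm (ip (S w) z) \<le> L * norm z"
  proof (rule uniform_boundedness)
    fix z
    have "norm (ip (S w) z) \<le> sqrt (norm (ell2_ip (V z) (V z)))" if w: "w \<in> W" for w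
    proof -
      obtain N where N: "\<And>n. n \<notin> {..<N} \<Longrightarrow> w n = 0" "norm (\<Sum>n<N. star (w n) * w n) \<le> 1"
        using w unfolding W_def by blast
      have "norm (ip (S w) z) = norm (ip z (S w))" by (metis norm_star star_ip)
      also have "ip z (S w) = ell2_ip (V z) w" using adj W_ell2[OF w] by simp
      also have "\<dots> = (\<Sum>n<N. star (V z n) * w n)"
        using N(1) by (intro ell2_ip_finite_support) auto
      finally have "(norm (ip (S w) z))\<^sup>2 \<le> norm (P N z) * norm (\<Sum>n<N. star (w n) * w n)"
        using norm_sum_star_mult_le[of "V z" w "{..<N}"] by (simp add: P_def)
      also have "\<dots> \<le> norm (ell2_ip (V z) (V z)) * 1"
        by (intro mult_mono P_le N(2)) simp_all
      finally show ?thesis by (intro real_le_rsqrt) simp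
    qed
    then show "\<exists>C. \<forall>w\<in>W. norm (ip (S w) z) \<le> C" by blast
  qed (rule bounded_linear_ip)
  then obtain L where L: "L \<ge> 0" "\<And>w z. w \<in> W \<Longrightarrow> norm (ip (S w) z) \<le> L * norm z"
    by blast
  have P_bound: "norm (P N z) \<le> L\<^sup>2 * (norm z)\<^sup>2" for N z
  proof (cases "norm (P N z) = 0")
    case False
    define s where "s = sqrt (norm (P N z))"
    have s: "s > 0" "s * s = norm (P N z)" using False by (simp_all add: s_def)
    \<comment> \<open>The normalized truncation of \<open>V z\<close>: its product with
      \<open>V z\<close> has norm exactly s.\<close>
    define w where "w n = (if n < N then (1 / s) *\<^sub>R V z n else 0)" for n
    have "(\<Sum>n<N. star (w n) * w n) = (1 / (s * s)) *\<^sub>R P N z"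
      by (simp add: w_def P_def scaleR_sum_right star_scaleR)
    then have "norm (\<Sum>n<N. star (w n) * w n) = 1" using s False by simp
    then have w: "w \<in> W" by (auto simp: W_def w_def intro!: exI[of _ N])
    have "ip z (S w) = (\<Sum>n<N. star (V z n) * w n)"
      using adj[OF W_ell2[OF w], of z] ell2_ip_finite_support[of "{..<N}" w "V z"]
      by (simp add: w_def)
    also have "\<dots> = (1 / s) *\<^sub>R P N z"
      by (simp add: w_def P_def scaleR_sum_right)
    finally have "norm (ip z (S w)) = s"
      using s by (simp add: field_simps)
    moreover have "norm (ip z (S w)) = norm (ip (S w) z)" by (metis norm_star star_ip)
    ultimately have "s \<le> L * norm z" using L(2)[OF w, of z] by simp
    then have "s\<^sup>2 \<le> (L * norm z)\<^sup>2" using s by (intro power_mono) simp_all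
    then show ?thesis using s by (simp add: power2_eq_square mult_ac)
  qed simp
  have "norm (ell2_ip (V z) (V z)) \<le> L\<^sup>2 * (norm z)\<^sup>2" for z
    unfolding ell2_ip_def
    by (rule Lim_bounded[OF tendsto_norm[OF summable_LIMSEQ[OF summ]], of 0])
      (use P_bound in \<open>simp add: P_def\<close>)
  then show ?thesis by (intro exI[of _ "L\<^sup>2"]) simp
qed

text \<open>The two alternatives differ only in whether every member lies in the image of the
  module. Whether the perturbed sequence is of the same kind as the given one therefore never has to
  be decided.\<close>

lemma frame_or_outer_frame_iff:
  "frame_or_outer_frame act ip v \<longleftrightarrow> range v \<subseteq> multiplier_module ip \<and> (\<exists>A B. frame_bounds ip v A B)"
proof
  assume "frame_or_outer_frame act ip v"
  then show "range v \<subseteq> multiplier_module ip \<and> (\<exists>A B. frame_bounds ip v A B)"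
    unfolding frame_or_outer_frame_def is_outer_frame_def is_frame_iff using mult_embed_in by blast
next
  assume v: "range v \<subseteq> multiplier_module ip \<and> (\<exists>A B. frame_bounds ip v A B)"
  show "frame_or_outer_frame act ip v"
  proof (cases "\<forall>n. v n \<in> range (mult_embed act)")
    case True
    then have "\<forall>n. \<exists>f. v n = mult_embed act f" by blast
    then obtain f where "\<forall>n. v n = mult_embed act (f n)" by (rule choice[THEN exE])
    then have "v = (\<lambda>n. mult_embed act (f n))" by (simp add: fun_eq_iff)
    with v show ?thesis unfolding frame_or_outer_frame_def is_frame_iff by blast
  next
    case False
    with v show ?thesis unfolding frame_or_outer_frame_def is_outer_frame_def by blast
  qed
qed

text \<open>\<open>GREATEST\<close> is meaningful only if a maximum is attained. A nonzero vector
  keeps the lower bounds below B, and their supremum is again a lower bound since the positive cone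
  is closed.\<close>

lemma frame_bounds_optimal:
  assumes fb: "frame_bounds ip v A0 B" and nz: "(z0::'x) \<noteq> 0"
  shows "frame_bounds ip v (optimal_lower_bound ip v) B"
proof -
  define G where "G z = (\<Sum>n. star (mult_pairing ip (v n) z) * mult_pairing ip (v n) z)" for z
  define Q where "Q = {A. \<exists>B. frame_bounds ip v A B}"
  have fb_iff: "frame_bounds ip v A C \<longleftrightarrow> A > 0 \<and> C > 0 \<and>
    (\<forall>z. summable (\<lambda>n. star (mult_pairing ip (v n) z) * mult_pairing ip (v n) z)
      \<and> A *\<^sub>R ip z z \<le>\<^sub>C G z \<and> G z \<le>\<^sub>C C *\<^sub>R ip z z)" for A C
    by (simp add: frame_bounds_def G_def)
  have Q_le: "A \<le> B" if "A \<in> Q" for A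
  proof -
    have A: "A > 0" "A *\<^sub>R ip z0 z0 \<le>\<^sub>C G z0" "G z0 \<le>\<^sub>C B *\<^sub>R ip z0 z0" "B > 0"
      using that fb by (auto simp: Q_def fb_iff)
    have "norm (A *\<^sub>R ip z0 z0) \<le> norm (B *\<^sub>R ip z0 z0)"
      using A(1) ip_nonneg cstar_le_trans[OF A(2,3)] by (intro norm_mono nonneg_scaleR) auto
    then show ?thesis using A nz by (simp add: norm_ip_self)
  qed
  have A0: "A0 \<in> Q" using fb by (auto simp: Q_def)
  have bdd: "bdd_above Q" using Q_le by (rule bdd_aboveI)
  have fbS: "frame_bounds ip v (Sup Q) B"
    unfolding fb_iff
  proof (intro conjI allI)
    show "Sup Q > 0" using cSup_upper[OF A0 bdd] fb by (simp add: fb_iff)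
    show "0 < B" using fb by (simp add: fb_iff)
    fix z
    show "summable (\<lambda>n. star (mult_pairing ip (v n) z) * mult_pairing ip (v n) z)"
      "G z \<le>\<^sub>C B *\<^sub>R ip z z"
      using fb by (simp_all add: fb_iff)
    have "\<exists>X. (\<forall>n. X n \<in> Q) \<and> X \<longlonglongrightarrow> Sup Q"
      using closure_contains_Sup[OF _ bdd] A0 by (auto simp: closure_sequential)
    then obtain X where X: "\<And>n. X n \<in> Q" "X \<longlonglongrightarrow> Sup Q" by blast
    have "0 \<le>\<^sub>C G z - Sup Q *\<^sub>R ip z z"
    proof (rule nonneg_LIMSEQ)
      show "0 \<le>\<^sub>C G z - X n *\<^sub>R ip z z" for n
        using X(1)[of n] by (auto simp: Q_def fb_iff cstar_le_iff_diff[of "X n *\<^sub>R _"])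
      show "(\<lambda>n. G z - X n *\<^sub>R ip z z) \<longlonglongrightarrow> G z - Sup Q *\<^sub>R ip z z"
        by (intro tendsto_intros X(2))
    qed
    then show "Sup Q *\<^sub>R ip z z \<le>\<^sub>C G z" by (simp add: cstar_le_iff_diff[of "Sup Q *\<^sub>R _"])
  qed
  have "optimal_lower_bound ip v = Sup Q"
    unfolding optimal_lower_bound_def
    by (rule Greatest_equality) (use fbS cSup_upper[OF _ bdd] in \<open>auto simp: Q_def\<close>)
  with fbS show ?thesis by simp
qed

end


section \<open>Differences and norms in the standard module\<close>

lemma ell2_diff:
  assumes u: "u \<in> ell2" and v: "v \<in> ell2"
  shows "(\<lambda>n. u n - v n) \<in> ell2"
    and "norm (ell2_ip (\<lambda>n. u n - v n) (\<lambda>n. u n - v n))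
      \<le> 2 * norm (ell2_ip u u) + 2 * norm (ell2_ip v v)"
proof -
  let ?d = "\<lambda>n. star (u n - v n) * (u n - v n)"
  let ?f = "\<lambda>n. 2 *\<^sub>R (star (u n) * u n) + 2 *\<^sub>R (star (v n) * v n)"
  have su: "summable (\<lambda>n. star (u n) * u n)" and sv: "summable (\<lambda>n. star (v n) * v n)"
    using u v by (simp_all add: ell2_def)
  have f: "summable ?f"
    by (intro summable_add summable_scaleR_right su sv)
  have le: "?d n \<le>\<^sub>C ?f n" for n
    \<comment> \<open>With a = u - v and b = -v the difference a - b is u, and weight 1 gives both
      coefficients 2.\<close>
    using star_mult_self_le_weighted[of 1 "u n - v n" "- v n"]
    by (simp add: star_minus add.commute)
  have d: "summable ?d" by (rule summable_cstar_le[OF f _ le]) simp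
  then show "(\<lambda>n. u n - v n) \<in> ell2" by (simp add: ell2_def)
  have "0 \<le>\<^sub>C (\<Sum>n. ?f n - ?d n)"
    using le by (intro nonneg_suminf summable_diff f d) (simp add: cstar_le_iff_diff[of "star _ * _"])
  then have "suminf ?d \<le>\<^sub>C suminf ?f"
    by (simp add: suminf_diff[OF f d, symmetric] cstar_le_iff_diff[of "suminf _"])
  then have "norm (suminf ?d) \<le> norm (suminf ?f)"
    by (intro norm_mono nonneg_suminf d) simp
  also have "suminf ?f = 2 *\<^sub>R (\<Sum>n. star (u n) * u n) + 2 *\<^sub>R (\<Sum>n. star (v n) * v n)"
    by (simp add: suminf_add[symmetric] suminf_scaleR_right summable_scaleR_right su sv)
  also have "norm \<dots> \<le> 2 * norm (\<Sum>n. star (u n) * u n) + 2 * norm (\<Sum>n. star (v n) * v n)"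
    by (rule order_trans[OF norm_triangle_ineq]) simp
  finally show "norm (ell2_ip (\<lambda>n. u n - v n) (\<lambda>n. u n - v n))
      \<le> 2 * norm (ell2_ip u u) + 2 * norm (ell2_ip v v)"
    by (simp add: ell2_ip_def)
qed

lemma norm_le_ell2_norm:
  assumes "u \<in> ell2"
  shows "norm (u n) \<le> ell2_norm u"
proof -
  have "norm (\<Sum>k\<in>{n}. star (u k) * u k) \<le> norm (ell2_ip u u)"
    using assms unfolding ell2_ip_def ell2_def
    by (intro norm_mono nonneg_sum sum_le_suminf_cstar) simp_all
  then have "(norm (u n))\<^sup>2 \<le> norm (ell2_ip u u)" by (simp add: norm_star_mult_self)
  then show ?thesis unfolding ell2_norm_def by (rule real_le_rsqrt)
qed

lemma ell2_norm_power2: "(ell2_norm u)\<^sup>2 = norm (ell2_ip u u)"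
  by (simp add: ell2_norm_def)

lemma ell2_norm_scaleR:
  assumes "u \<in> ell2"
  shows "ell2_norm (\<lambda>n. r *\<^sub>R u n) = \<bar>r\<bar> * ell2_norm u"
proof -
  have "ell2_ip (\<lambda>n. r *\<^sub>R u n) (\<lambda>n. r *\<^sub>R u n) = (r * r) *\<^sub>R ell2_ip u u"
    using assms by (simp add: ell2_ip_def ell2_def star_scaleR suminf_scaleR_right)
  then show ?thesis by (simp add: ell2_norm_def real_sqrt_mult abs_mult)
qed

text \<open>Some bound C, however crude, is required first: only then is the supremum an upper bound
  of the values on the unit ball, which scaling extends to all vectors.\<close>

lemma ell2_norm_le_onorm_ell2:
  fixes T :: "'x::real_normed_vector \<Rightarrow> nat \<Rightarrow> 'a::cstar_algebra"
  assumes ell2: "\<And>z. T z \<in> ell2"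
    and scale: "\<And>r z. T (r *\<^sub>R z) = (\<lambda>n. r *\<^sub>R T z n)"
    and bound: "\<And>z. norm (ell2_ip (T z) (T z)) \<le> C * (norm z)\<^sup>2"
  shows "ell2_norm (T z) \<le> onorm_ell2 T * norm z" and "0 \<le> onorm_ell2 T"
proof -
  have bdd: "bdd_above ((\<lambda>z. ell2_norm (T z)) ` {z. norm z \<le> 1})"
  proof (rule bdd_aboveI2)
    fix z :: 'x assume "z \<in> {z. norm z \<le> 1}"
    then have "(norm z)\<^sup>2 \<le> 1" by (simp add: power_le_one)
    then have "\<bar>C\<bar> * (norm z)\<^sup>2 \<le> \<bar>C\<bar> * 1" by (intro mult_left_mono) simp_all
    moreover have "C * (norm z)\<^sup>2 \<le> \<bar>C\<bar> * (norm z)\<^sup>2" by (intro mult_right_mono) simp_all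
    ultimately show "ell2_norm (T z) \<le> sqrt \<bar>C\<bar>"
      using bound[of z] by (simp add: ell2_norm_def)
  qed
  have unit: "ell2_norm (T z) \<le> onorm_ell2 T" if "norm z \<le> 1" for z
    unfolding onorm_ell2_def by (rule cSUP_upper[OF _ bdd]) (use that in simp)
  have "0 \<le> ell2_norm (T 0)" by (simp add: ell2_norm_def)
  then show "0 \<le> onorm_ell2 T" using unit[of 0] by simp
  show "ell2_norm (T z) \<le> onorm_ell2 T * norm z"
  proof (cases "z = 0")
    case True
    then show ?thesis using bound[of 0] by (simp add: ell2_norm_def)
  next
    case False
    have "ell2_norm (T ((1 / norm z) *\<^sub>R z)) \<le> onorm_ell2 T"
      using False by (intro unit) simp
    then show ?thesis
      using False by (simp add: scale ell2_norm_scaleR[OF ell2] field_simps)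
  qed
qed

section \<open>The perturbed frame\<close>

context hilbert_module
begin

text \<open>Without a unit there is no vector e_n, only its multiples \<open>unit_vec n a\<close>.
  The n-th member is thus the map sending a to the adjoint of V at \<open>unit_vec n a\<close>,
  whose own adjoint is the n-th coordinate of V.\<close>

lemma adjointable_ell2_eq_analysis_operator:
  assumes "V \<in> adjointable_ell2 ip"
  obtains y where "\<And>n. y n \<in> multiplier_module ip" "V = analysis_operator ip y"
proof -
  obtain S where "is_adjoint UNIV ip ell2 ell2_ip V S"
    using assms by (auto simp: adjointable_ell2_def adjointable_def)
  then have adj: "ell2_ip (V z) w = ip z (S w)" if "w \<in> ell2" for z w
    using that by (simp add: is_adjoint_def)
  define y where "y n a = S (unit_vec n a)" for n a
  have "ip (y n a) z = star a * V z n" for n a z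
  proof -
    have "ip z (y n a) = star (V z n) * a"
      by (simp add: y_def adj[OF unit_vec_in_ell2, symmetric] ell2_ip_unit_vec)
    then have "star (ip z (y n a)) = star a * V z n" by (simp add: star_mult)
    then show ?thesis by (simp add: star_ip)
  qed
  then have y: "is_adjoint UNIV cstar_ip UNIV ip (y n) (\<lambda>z. V z n)" for n
    by (simp add: is_adjoint_def cstar_ip_def)
  show thesis
  proof (rule that)
    show "y n \<in> multiplier_module ip" for n
      using y by (auto simp: multiplier_module_def adjointable_def)
    show "V = analysis_operator ip y"
      by (simp add: fun_eq_iff analysis_operator_def mult_pairing_def mult_adj_unique[OF y])
  qed
qed

lemma mult_diff_in:
  assumes v: "v \<in> multiplier_module ip" and w: "w \<in> multiplier_module ip"
  shows "(\<lambda>a. v a - w a) \<in> multiplier_module ip"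
    and "mult_pairing ip (\<lambda>a. v a - w a) z = mult_pairing ip v z - mult_pairing ip w z"
proof -
  have "is_adjoint UNIV cstar_ip UNIV ip (\<lambda>a. v a - w a) (\<lambda>z. mult_adj ip v z - mult_adj ip w z)"
    by (simp add: is_adjoint_def cstar_ip_def ip_diff_left mult_adj_ip[OF v] mult_adj_ip[OF w]
      right_diff_distrib)
  then show "(\<lambda>a. v a - w a) \<in> multiplier_module ip"
    "mult_pairing ip (\<lambda>a. v a - w a) z = mult_pairing ip v z - mult_pairing ip w z"
    by (auto simp: multiplier_module_def adjointable_def mult_pairing_def dest: mult_adj_unique)
qed

text \<open>A bound for the adjoint passes to v, since \<open>ip (v a) (v a)\<close> is
  \<open>star a\<close> times the adjoint at \<open>v a\<close>. Both bounds together give M^2 for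
  the composite.\<close>

lemma mult_norm_le:
  assumes v: "v \<in> multiplier_module ip" and M: "0 \<le> M"
    and le: "\<And>z. norm (mult_pairing ip v z) \<le> M * norm z"
  shows "mult_norm ip v \<le> M"
proof -
  have v_le: "norm (v a) \<le> M * norm a" for a
  proof (cases "norm (v a) = 0")
    case False
    have "norm (v a) * norm (v a) = norm (star a * mult_adj ip v (v a))"
      using norm_ip_self[of "v a"] by (simp add: mult_adj_ip[OF v] power2_eq_square)
    also have "\<dots> \<le> norm a * (M * norm (v a))"
      using norm_mult_ineq[of "star a" "mult_adj ip v (v a)"]
        mult_left_mono[OF le[of "v a"], of "norm a"] by (simp add: mult_pairing_def)
    finally have "norm (v a) * norm (v a) \<le> (M * norm a) * norm (v a)" by (simp add: mult_ac)
    then show ?thesis using False by simp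
  qed (use M in simp)
  have "onorm (mult_ip ip v v) \<le> M\<^sup>2"
  proof (rule onorm_bound)
    fix a
    have "norm (mult_ip ip v v a) \<le> M * norm (v a)"
      using le[of "v a"] by (simp add: mult_ip_def mult_pairing_def)
    also have "\<dots> \<le> M * (M * norm a)" by (intro mult_left_mono v_le M)
    finally show "norm (mult_ip ip v v a) \<le> M\<^sup>2 * norm a" by (simp add: power2_eq_square mult_ac)
  qed simp
  then have "sqrt (onorm (mult_ip ip v v)) \<le> sqrt (M\<^sup>2)" by (rule real_sqrt_le_mono)
  then show ?thesis using M by (simp add: mult_norm_def)
qed

lemma frame_perturbation:
  assumes frame: "frame_or_outer_frame act ip x"
    and V: "V \<in> adjointable_ell2 ip"
    and small: "onorm_ell2 (\<lambda>z n. analysis_operator ip x z n - V z n) < sqrt (optimal_lower_bound ip x)"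
  shows "\<exists>y. frame_or_outer_frame act ip y \<and> V = analysis_operator ip y \<and>
    (\<forall>n. mult_norm ip (\<lambda>a. x n a - y n a) \<le> onorm_ell2 (\<lambda>z n. analysis_operator ip x z n - V z n))"
proof -
  obtain A0 B where fb: "frame_bounds ip x A0 B" and "range x \<subseteq> multiplier_module ip"
    using frame by (auto simp: frame_or_outer_frame_iff)
  then have x: "x n \<in> multiplier_module ip" for n by blast
  obtain y where y: "\<And>n. y n \<in> multiplier_module ip" and Vy: "V = analysis_operator ip y"
    using adjointable_ell2_eq_analysis_operator[OF V] by metis
  define d where "d n = (\<lambda>a. x n a - y n a)" for n
  have d: "d n \<in> multiplier_module ip" and
    pd: "mult_pairing ip (d n) z = mult_pairing ip (x n) z - mult_pairing ip (y n) z" for n z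
    unfolding d_def by (rule mult_diff_in[OF x y])+
  let ?D = "analysis_operator ip d"
  have D_eq: "(\<lambda>z n. analysis_operator ip x z n - V z n) = ?D"
    by (simp add: fun_eq_iff Vy analysis_operator_def pd)
  define M where "M = onorm_ell2 ?D"
  define G where "G w z = (\<Sum>n. star (mult_pairing ip (w n) z) * mult_pairing ip (w n) z)" for w z
  have G_ell2: "ell2_ip (analysis_operator ip w z) (analysis_operator ip w z) = G w z" for w z
    by (simp add: ell2_ip_def analysis_operator_def G_def)
  have U: "analysis_operator ip x z \<in> ell2" "norm (G x z) \<le> B * (norm z)\<^sup>2" for z
  proof -
    show "analysis_operator ip x z \<in> ell2"
      using fb by (simp add: ell2_def analysis_operator_def frame_bounds_def)
    then have "0 \<le>\<^sub>C G x z"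
      unfolding G_def by (intro nonneg_suminf) (simp_all add: ell2_def analysis_operator_def)
    then have "norm (G x z) \<le> norm (B *\<^sub>R ip z z)"
      using fb by (intro norm_mono) (simp_all add: frame_bounds_def G_def)
    then show "norm (G x z) \<le> B * (norm z)\<^sup>2"
      using fb by (simp add: norm_ip_self frame_bounds_def)
  qed
  obtain L where L: "L \<ge> 0" "\<And>z. norm (G y z) \<le> L * (norm z)\<^sup>2"
    using adjointable_ell2_bounded[OF V] by (auto simp: Vy G_ell2)
  have Y: "analysis_operator ip y z \<in> ell2" for z
    using V by (auto simp: Vy adjointable_ell2_def adjointable_def is_adjoint_def)
  \<comment> \<open>This crude bound serves only to make the supremum defining M finite.\<close>
  have D: "?D z \<in> ell2" "norm (G d z) \<le> (2 * B + 2 * L) * (norm z)\<^sup>2" for z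
  proof -
    have eq: "(\<lambda>n. analysis_operator ip x z n - analysis_operator ip y z n) = ?D z"
      by (simp add: fun_eq_iff analysis_operator_def pd)
    show "?D z \<in> ell2" using ell2_diff(1)[OF U(1)[of z] Y[of z]] by (simp add: eq)
    have "norm (G d z) \<le> 2 * norm (G x z) + 2 * norm (G y z)"
      using ell2_diff(2)[OF U(1)[of z] Y[of z]] by (simp add: eq G_ell2)
    then show "norm (G d z) \<le> (2 * B + 2 * L) * (norm z)\<^sup>2"
      using U(2)[of z] L(2)[of z] by (simp add: algebra_simps)
  qed
  have M: "ell2_norm (?D z) \<le> M * norm z" "0 \<le> M" for z
    unfolding M_def
    by (rule ell2_norm_le_onorm_ell2[where C = "2 * B + 2 * L"];
      (simp add: D G_ell2)?; simp add: analysis_operator_def fun_eq_iff mult_pairing_scaleR d)+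
  have summ: "summable (\<lambda>n. star (mult_pairing ip (x n) z) * mult_pairing ip (x n) z)"
    "summable (\<lambda>n. star (mult_pairing ip (y n) z) * mult_pairing ip (y n) z)"
    "summable (\<lambda>n. star (mult_pairing ip (d n) z) * mult_pairing ip (d n) z)" for z
    using U(1)[of z] Y[of z] D(1)[of z] by (simp_all add: ell2_def analysis_operator_def)
  have Gy_le: "G y z \<le>\<^sub>C L *\<^sub>R ip z z" for z
    unfolding G_def by (rule analysis_operator_le[OF y summ(2) _ L(1)]) (use L(2) in \<open>simp add: G_def\<close>)
  have "norm (G d z) \<le> M\<^sup>2 * (norm z)\<^sup>2" for z
    using power_mono[OF M(1)[of z], of 2]
    by (simp add: ell2_norm_power2 G_ell2 power_mult_distrib) (simp add: ell2_norm_def)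
  then have Gd_le: "G d z \<le>\<^sub>C M\<^sup>2 *\<^sub>R ip z z" for z
    unfolding G_def by (intro analysis_operator_le[OF d summ(3)]) simp_all
  have "\<exists>A B. frame_bounds ip y A B"
  proof (cases "\<exists>z0::'x. z0 \<noteq> 0")
    \<comment> \<open>In the zero module \<open>optimal_lower_bound\<close> carries no information,
      but any positive constants are frame bounds.\<close>
    case False
    then have z0: "z = 0" for z :: 'x by blast
    have "mult_pairing ip (y n) z = 0" for n z
      using mult_pairing_scaleR[OF y, of n 0 z] z0[of z] by simp
    moreover have "ip z z = 0" for z using z0[of z] by simp
    ultimately have "frame_bounds ip y 1 1" by (simp add: frame_bounds_def)
    then show ?thesis by blast
  next
    case True
    define A where "A = optimal_lower_bound ip x"
    have fbA: "frame_bounds ip x A B"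
      unfolding A_def using True frame_bounds_optimal[OF fb] by blast
    have A: "M\<^sup>2 < A"
      using power_strict_mono[OF small[unfolded D_eq, folded M_def A_def] M(2), of 2] fbA
      by (simp add: frame_bounds_def)
    \<comment> \<open>Chosen so that t (A - M^2) = A > M^2, which is c > 0; the summand 1 keeps t
      positive when M = 0.\<close>
    define t where "t = M\<^sup>2 / (A - M\<^sup>2) + 1"
    have t: "t > 0" using A by (simp add: t_def add_nonneg_pos)
    define c where "c = A - (1 + 1/t) * M\<^sup>2"
    have "M\<^sup>2 < t * (A - M\<^sup>2)" using A by (simp add: t_def distrib_right)
    then have c: "c > 0" using t by (simp add: c_def field_simps)
    have "c *\<^sub>R ip z z \<le>\<^sub>C (1 + t) *\<^sub>R G y z" for z
    proof -
      let ?f = "\<lambda>n. (1 + t) *\<^sub>R (star (mult_pairing ip (y n) z) * mult_pairing ip (y n) z)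
        + (1 + 1/t) *\<^sub>R (star (mult_pairing ip (d n) z) * mult_pairing ip (d n) z)
        - star (mult_pairing ip (x n) z) * mult_pairing ip (x n) z"
      have "?f sums ((1 + t) *\<^sub>R G y z + (1 + 1/t) *\<^sub>R G d z - G x z)"
        unfolding G_def by (intro sums_diff sums_add sums_scaleR_right summable_sums summ)
      moreover have "0 \<le>\<^sub>C ?f n" for n
        using star_mult_self_le_weighted[OF t, of "mult_pairing ip (x n) z" "mult_pairing ip (y n) z"]
        by (simp add: pd cstar_le_iff_diff[of "star _ * _"])
      ultimately have 1: "0 \<le>\<^sub>C (1 + t) *\<^sub>R G y z + (1 + 1/t) *\<^sub>R G d z - G x z"
        using nonneg_suminf[of ?f] by (simp add: sums_iff)
      have 2: "0 \<le>\<^sub>C G x z - A *\<^sub>R ip z z"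
        using fbA by (simp add: frame_bounds_def G_def cstar_le_iff_diff[of "A *\<^sub>R _"])
      have 3: "0 \<le>\<^sub>C (1 + 1/t) *\<^sub>R (M\<^sup>2 *\<^sub>R ip z z - G d z)"
        using Gd_le[of z] t by (intro nonneg_scaleR) (simp_all add: cstar_le_iff_diff[of "G d z"])
      have eq: "(1 + t) *\<^sub>R G y z - c *\<^sub>R ip z z =
        ((1 + t) *\<^sub>R G y z + (1 + 1/t) *\<^sub>R G d z - G x z) + (G x z - A *\<^sub>R ip z z)
          + (1 + 1/t) *\<^sub>R (M\<^sup>2 *\<^sub>R ip z z - G d z)"
        by (simp add: c_def scaleR_diff_right scaleR_diff_left)
      have "0 \<le>\<^sub>C (1 + t) *\<^sub>R G y z - c *\<^sub>R ip z z"
        unfolding eq by (rule nonneg_add[OF nonneg_add[OF 1 2] 3])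
      then show ?thesis by (simp add: cstar_le_iff_diff[of "c *\<^sub>R _"])
    qed
    then have "0 \<le>\<^sub>C (1 / (1 + t)) *\<^sub>R ((1 + t) *\<^sub>R G y z - c *\<^sub>R ip z z)" for z
      using t by (intro nonneg_scaleR) (simp_all add: cstar_le_iff_diff[of "c *\<^sub>R _"])
    then have low: "(c / (1 + t)) *\<^sub>R ip z z \<le>\<^sub>C G y z" for z
      using t by (simp add: scaleR_diff_right cstar_le_iff_diff[of "(c / (1 + t)) *\<^sub>R _"])
    \<comment> \<open>An upper frame bound must be positive, and L may be 0; hence L + 1.\<close>
    have "0 \<le>\<^sub>C (L *\<^sub>R ip z z - G y z) + ip z z" for z
      using Gy_le[of z] by (intro nonneg_add ip_nonneg) (simp add: cstar_le_iff_diff[of "G y z"])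
    then have up: "G y z \<le>\<^sub>C (L + 1) *\<^sub>R ip z z" for z
      by (simp add: cstar_le_iff_diff[of "G y z"] scaleR_left_distrib algebra_simps)
    have "frame_bounds ip y (c / (1 + t)) (L + 1)"
      using c t L(1) summ(2) low up by (simp add: frame_bounds_def G_def)
    then show ?thesis by blast
  qed
  then have "frame_or_outer_frame act ip y"
    using y by (auto simp: frame_or_outer_frame_iff)
  moreover have "mult_norm ip (d n) \<le> M" for n
  proof (rule mult_norm_le[OF d M(2)])
    fix z
    show "norm (mult_pairing ip (d n) z) \<le> M * norm z"
      using norm_le_ell2_norm[OF D(1), of z n] M(1)[of z] by (simp add: analysis_operator_def)
  qed
  ultimately show ?thesis
    unfolding D_eq using Vy by (auto simp: M_def d_def)
qed

end

theorem theorem5p2: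
  fixes act :: "'x::{complex_normed_vector, banach} \<Rightarrow> 'a::cstar_algebra \<Rightarrow> 'x"
    and ip :: "'x \<Rightarrow> 'x \<Rightarrow> 'a"
    and x :: "nat \<Rightarrow> 'a \<Rightarrow> 'x"
    and U V :: "'x \<Rightarrow> nat \<Rightarrow> 'a"
    and A :: real
  assumes "hilbert_module act ip"
    and "frame_or_outer_frame act ip x"
    and "U = analysis_operator ip x"
    and "A = optimal_lower_bound ip x"
    and "V \<in> adjointable_ell2 ip"
    and "onorm_ell2 (\<lambda>z n. U z n - V z n) < sqrt A"
  shows "\<exists>y. frame_or_outer_frame act ip y \<and> V = analysis_operator ip y \<and>
    (\<forall>n. mult_norm ip (\<lambda>a. x n a - y n a) \<le> onorm_ell2 (\<lambda>z n. U z n - V z n) \<and>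
         onorm_ell2 (\<lambda>z n. U z n - V z n) < sqrt A)"
  using hilbert_module.frame_perturbation[OF assms(1,2,5)] assms(3,4,6) by auto

end
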